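(* Let $n$ and $m$ be positive integers, and let $\mathbf r=(r_1,\dots,r_m)$ and $\mathbf s=(s_1,\dots,s_m)$ be weak compositions of $r$ and $s$ respectively (i.e. $r_k,s_k\in\mathbb Z_{\ge 0}$, $\sum_k r_k=r$, $\sum_k s_k=s$). Let $N=m\binom n2+(r+s+1)n+\sum_{k=1}^m r_ks_k$. Then for $0<q<1$, \[ \frac{1}{n!}\int_0^1\cdots\int_0^1 \prod_{k=1}^m\Big(\prod_{i=1}^n x_i^{r_k}(qx_i;q)_{s_k}\prod_{1\le i<j\le n}|x_j-x_i|\Big)\,d_qx_1\cdots d_qx_n = q^{(r+1)\binom n2+m\binom n3}\,\frac{1}{[N]_q!}\prod_{k=1}^m\frac{F_q(n+r_k+s_k)}{F_q(r_k)F_q(s_k)}\sum_{B\in \mathrm{YB}(n;\mathbf r,\mathbf s)} q^{\mathrm{maj}(B)} . \]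
   Context: Notation: $(x;q)_s=\prod_{i=0}^{s-1}(1-xq^i)$, so $(qx;q)_s=\prod_{i=1}^s(1-q^ix)$; $[i]_q=(1-q^i)/(1-q)$, $[i]_q!=[1]_q[2]_q\cdots[i]_q$, and $F_q(l)=\prod_{i=1}^{l-1}[i]_q!$ (empty product $=1$). The Jackson integral over $[0,1]^n$ is $\int_{[0,1]^n} f\,d_qx=(1-q)^n\sum_{k_1,\dots,k_n\ge0} f(q^{k_1},\dots,q^{k_n})\,q^{k_1+\cdots+k_n}$. Young books: For nonnegative integers $n,a,b$, an $(n,a,b)$-staircase is the set of cells $(i,j)$ with row label $i\in\{-a+1,\dots,n\}$, column label $j\in\{1,\dots,n+b\}$, and $j\ge i$ (an $(a+n)\times(n+b)$ rectangle with the staircase $(n-1,\dots,1)$ removed from the lower-left corner). For $1\le i\le n$ the cell $(i,i)$ is the $i$th diagonal cell. An $(n,\mathbf r,\mathbf s)$-staircase is an $m$-tuple of pages, the $k$th page being an $(n,r_k,s_k)$-staircase, where for each $j=1,\dots,n$ the $j$th diagonal cells of all pages are identified into one cell; it has $N$ cells. An $(n,\mathbf r,\mathbf s)$-Young book is a bijective filling of the cells of an $(n,\mathbf r,\mathbf s)$-staircase with $1,\dots,N$ such that within each page (diagonal cells belonging to every page) entries increase from left to right along rows and from top to bottom along columns. $\mathrm{YB}(n;\mathbf r,\mathbf s)$ is the set of these. For such a book $B$, $i\in\{1,\dots,N-1\}$ is a descent if either (1) the row label of the cell containing $i+1$ is smaller than the row label of the cell containing $i$ (regardless of pages), or (2)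 $i$ and $i+1$ are both in non-diagonal cells with the same row label and $i+1$ lies in a page with smaller index than the page of $i$. $\mathrm{maj}(B)$ is the sum of the descents of $B$. *)

theory Defs
  imports "HOL-Analysis.Analysis"
begin

definition q_poch :: "real \<Rightarrow> real \<Rightarrow> nat \<Rightarrow> real" where
  "q_poch x q s = (\<Prod>i<s. 1 - x * q ^ i)"

definition q_bracket :: "real \<Rightarrow> nat \<Rightarrow> real" where
  "q_bracket q i = (1 - q ^ i) / (1 - q)"

definition q_fact :: "real \<Rightarrow> nat \<Rightarrow> real" where
  "q_fact q n = (\<Prod>i=1..n. q_bracket q i)"

definition q_superfact :: "real \<Rightarrow> nat \<Rightarrow> real" where
  "q_superfact q l = (\<Prod>i=1..<l. q_fact q i)"

text \<open>Points of \<open>[0,1]\<^sup>n\<close> are functions on the index set \<open>{1..n}\<close>, made extensional outside it.\<close>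

definition jackson_integral :: "real \<Rightarrow> nat \<Rightarrow> ((nat \<Rightarrow> real) \<Rightarrow> real) \<Rightarrow> real" where
  "jackson_integral q n f =
     (1 - q) ^ n *
     (\<Sum>\<^sub>\<infinity>k\<in>{1..n} \<rightarrow>\<^sub>E (UNIV :: nat set).
        f (\<lambda>i\<in>{1..n}. q ^ k i) * q ^ (\<Sum>i=1..n. k i))"

definition staircase :: "nat \<Rightarrow> nat \<Rightarrow> nat \<Rightarrow> (int \<times> int) set" where
  "staircase n a b =
     {(i, j). - int a + 1 \<le> i \<and> i \<le> int n \<and> 1 \<le> j \<and> j \<le> int n + int b \<and> i \<le> j}"

text \<open>
  Cells of a book: a diagonal cell carries only its label, since it is shared by all pages;
  \<open>Off k i j\<close> is the non-diagonal cell in row \<open>i\<close> and column \<open>j\<close> of page \<open>k\<close>.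
\<close>

datatype book_cell = Diag int | Off nat int int

primrec cell_row :: "book_cell \<Rightarrow> int" where
  "cell_row (Diag i) = i"
| "cell_row (Off k i j) = i"

definition page_cell :: "nat \<Rightarrow> int \<times> int \<Rightarrow> book_cell" where
  "page_cell k = (\<lambda>(i, j). if i = j then Diag i else Off k i j)"

definition book_staircase ::
  "nat \<Rightarrow> nat \<Rightarrow> (nat \<Rightarrow> nat) \<Rightarrow> (nat \<Rightarrow> nat) \<Rightarrow> book_cell set" where
  "book_staircase n m rv sv = (\<Union>k\<in>{1..m}. page_cell k ` staircase n (rv k) (sv k))"

text \<open>Fillings are extensional, so that distinct members are distinct as fillings of the cells.\<close>

definition young_books ::
  "nat \<Rightarrow> nat \<Rightarrow> (nat \<Rightarrow> nat) \<Rightarrow> (nat \<Rightarrow> nat) \<Rightarrow> (book_cell \<Rightarrow> nat) set" where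
  "young_books n m rv sv =
     {B \<in> extensional (book_staircase n m rv sv).
        bij_betw B (book_staircase n m rv sv) {1..card (book_staircase n m rv sv)} \<and>
        (\<forall>k\<in>{1..m}. \<forall>i j j'.
           (i, j) \<in> staircase n (rv k) (sv k) \<and> (i, j') \<in> staircase n (rv k) (sv k) \<and> j < j' \<longrightarrow>
           B (page_cell k (i, j)) < B (page_cell k (i, j'))) \<and>
        (\<forall>k\<in>{1..m}. \<forall>i i' j.
           (i, j) \<in> staircase n (rv k) (sv k) \<and> (i', j) \<in> staircase n (rv k) (sv k) \<and> i < i' \<longrightarrow>
           B (page_cell k (i, j)) < B (page_cell k (i', j)))}"

definition descent_pair :: "book_cell \<Rightarrow> book_cell \<Rightarrow> bool" where
  "descent_pair c c' \<longleftrightarrow>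
     cell_row c' < cell_row c \<or>
     (\<exists>k k' i j j'. c = Off k i j \<and> c' = Off k' i j' \<and> k' < k)"

definition descents :: "book_cell set \<Rightarrow> (book_cell \<Rightarrow> nat) \<Rightarrow> nat set" where
  "descents C B =
     {i. 1 \<le> i \<and> i < card C \<and> descent_pair (inv_into C B i) (inv_into C B (i + 1))}"

definition maj :: "book_cell set \<Rightarrow> (book_cell \<Rightarrow> nat) \<Rightarrow> nat" where
  "maj C B = \<Sum>(descents C B)"

end

theory Submission
  imports Defs "Jordan_Normal_Form.Determinant"
begin


text \<open>
  Both sides are generating functions of order-reversing fillings of the cells of a book. The
  labelling of the cells by row, then page (diagonal cells first), then column is natural and
  its descents are the descents of Young books, so Stanley's theory of \<open>P\<close>-partitions gives
  \<open>\<Sum>\<^sub>B q ^ maj B\<close> divided by \<open>(1 - q) \<cdots> (1 - q ^ N)\<close>. On the other hand, once the diagonal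
  \<open>\<lambda> 1 \<ge> \<dots> \<ge> \<lambda> n\<close> is fixed, the pages are independent of each other. With
  \<open>x i = q ^ (\<lambda> i + n - i)\<close>, the generating function of one page is a constant times
  \<open>\<Prod> x i ^ a * (q x i; q)\<^sub>b\<close> times a Vandermonde product: peel the page diagonal by diagonal;
  consecutive diagonals interlace, and summing an alternant over interlacing sequences yields an
  alternant of antidifferences, which is again a Vandermonde product when the basis of polynomials
  is chosen well. The Jackson sum is \<open>n!\<close> times its restriction to strictly decreasing exponents.
\<close>

section \<open>Sums of alternants over interlacing sequences\<close>

text \<open>The obstacle is that interlacing couples neighbouring entries. Adding its position to
  each entry of a diagonal turns the weak inequalities into membership in disjoint intervals between
  knots, so the entries of the next diagonal range independently and a determinant can be summed row
  by row. The polynomial in each column is then found backwards: take as antidifference the weight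
  of the larger page times a power of \<open>- (q ^ s)\<close>, and divide its increment by the
  weight of the smaller page. The leading coefficients of the quotients multiply to the ratio of
  consecutive page constants, up to powers of \<open>q\<close>, and so build up the superfactorials.
  From one diagonal to the next a page may lose a cell at the bottom and may gain one on top, which
  gives four cases; where there are more entries than knots, one column has no closed
  antidifference, and its sum is the \<open>q\<close>-beta integral.\<close>

lemma has_sum_sum:
  fixes f :: "'a \<Rightarrow> 'b \<Rightarrow> 'c::topological_comm_monoid_add"
  assumes "finite I" and "\<And>i. i \<in> I \<Longrightarrow> (f i has_sum s i) A"
  shows "((\<lambda>x. \<Sum>i\<in>I. f i x) has_sum (\<Sum>i\<in>I. s i)) A"
  using assms by (induction I) (auto intro!: has_sum_add)

text \<open>Nonnegativity lets summability on the product set be read off from iterated sums, so the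
  induction can add one coordinate at a time; the signed version applies this to norms.\<close>

lemma has_sum_prod_PiE_nonneg:
  fixes f :: "'a \<Rightarrow> 'b \<Rightarrow> real"
  assumes "finite A" and "\<And>x. x \<in> A \<Longrightarrow> (f x has_sum s x) (B x)" and "\<And>x y. f x y \<ge> 0"
  shows "((\<lambda>g. \<Prod>x\<in>A. f x (g x)) has_sum (\<Prod>x\<in>A. s x)) (PiE A B)"
  using assms(1,2)
proof (induction A)
  case empty
  then show ?case by (simp add: has_sum_finiteI)
next
  case (insert x F)
  have pi: "Pi\<^sub>E (insert x F) B = (\<lambda>(g,y). g(x:=y)) ` (Pi\<^sub>E F B \<times> B x)"
    unfolding PiE_insert_eq
    by (subst swap_product [symmetric]) (simp add: image_image case_prod_unfold)
  have inj: "inj_on (\<lambda>(g, y). g(x := y)) (Pi\<^sub>E F B \<times> B x)"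
    using \<open>x \<notin> F\<close> by (rule inj_combinator')
  have eq: "((\<lambda>g. \<Prod>x\<in>insert x F. f x (g x)) \<circ> (\<lambda>(g, y). g(x := y)))
      = (\<lambda>(g, y). f x y * (\<Prod>z\<in>F. f z (g z)))"
  proof -
    have "(\<Prod>z\<in>F. f z ((g(x := y)) z)) = (\<Prod>z\<in>F. f z (g z))" for g y
      using insert.hyps by (intro prod.cong) auto
    then show ?thesis
      using insert.hyps by (auto simp: fun_eq_iff)
  qed
  let ?h = "\<lambda>(g, y). f x y * (\<Prod>z\<in>F. f z (g z))"
  have inner: "((\<lambda>y. ?h (g, y)) has_sum s x * (\<Prod>z\<in>F. f z (g z))) (B x)" for g
    using has_sum_cmult_left[of "f x" "B x" "s x"] insert.prems by simp
  have outer: "((\<lambda>g. s x * (\<Prod>z\<in>F. f z (g z))) has_sum s x * (\<Prod>z\<in>F. s z)) (PiE F B)"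
    using insert by (intro has_sum_cmult_right) auto
  have "?h summable_on (Pi\<^sub>E F B \<times> B x)"
    by (rule summable_on_SigmaI[OF inner has_sum_imp_summable[OF outer]])
       (auto intro!: mult_nonneg_nonneg prod_nonneg assms(3))
  then have "(?h has_sum s x * (\<Prod>z\<in>F. s z)) (Pi\<^sub>E F B \<times> B x)"
    by (rule has_sum_SigmaI[OF inner outer])
  then show ?case
    unfolding pi has_sum_reindex[OF inj] eq using insert.hyps by simp
qed

lemma has_sum_prod_PiE:
  fixes f :: "'a \<Rightarrow> 'b \<Rightarrow> real"
  assumes "finite A" and sums: "\<And>x. x \<in> A \<Longrightarrow> (f x has_sum s x) (B x)"
  shows "((\<lambda>g. \<Prod>x\<in>A. f x (g x)) has_sum (\<Prod>x\<in>A. s x)) (PiE A B)"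
proof -
  have abs: "(\<lambda>y. norm (f x y)) summable_on B x" if "x \<in> A" for x
    using has_sum_imp_summable[OF sums[OF that]] summable_on_iff_abs_summable_on_real by blast
  have "(\<lambda>g. \<Prod>x\<in>A. norm (f x (g x))) summable_on PiE A B"
    by (rule has_sum_imp_summable, rule has_sum_prod_PiE_nonneg[OF \<open>finite A\<close> has_sum_infsum])
       (use abs in auto)
  then have "(\<lambda>g. \<Prod>x\<in>A. f x (g x)) summable_on PiE A B"
    by (subst summable_on_iff_abs_summable_on_real) (simp add: abs_prod)
  then have "((\<lambda>g. \<Prod>x\<in>A. f x (g x)) has_sum (\<Prod>x\<in>A. infsum (f x) (B x))) (PiE A B)"
    using infsum_prod_PiE_abs[of A f B, OF \<open>finite A\<close> abs] has_sum_infsum by fastforce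
  also have "(\<Prod>x\<in>A. infsum (f x) (B x)) = (\<Prod>x\<in>A. s x)"
    using sums by (intro prod.cong) (auto intro: infsumI)
  finally show ?thesis .
qed

text \<open>Row \<open>p\<close> involves only \<open>y p\<close>, so each Leibniz term is a product
  with one factor per coordinate and sums factor by factor over the product set.\<close>

lemma has_sum_det_rows:
  fixes f :: "nat \<Rightarrow> 'a \<Rightarrow> real"
  assumes "\<And>p j. p < n \<Longrightarrow> j < n \<Longrightarrow> (f j has_sum s p j) (S p)"
  shows "((\<lambda>y. det (mat n n (\<lambda>(p, j). f j (y p)))) has_sum det (mat n n (\<lambda>(p, j). s p j)))
    (PiE {..<n} S)"
proof -
  have "((\<lambda>y. \<Sum>\<pi> \<in> {\<pi>. \<pi> permutes {0..<n}}. signof \<pi> * (\<Prod>i\<in>{..<n}. f (\<pi> i) (y i))) has_sum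
      (\<Sum>\<pi> \<in> {\<pi>. \<pi> permutes {0..<n}}. signof \<pi> * (\<Prod>i\<in>{..<n}. s i (\<pi> i)))) (PiE {..<n} S)"
  proof (intro has_sum_sum has_sum_cmult_right)
    fix \<pi> assume "\<pi> \<in> {\<pi>. \<pi> permutes {0..<n}}"
    then have "\<pi> i < n" if "i < n" for i
      using that permutes_in_image[of \<pi> "{0..<n}" i] by auto
    then show "((\<lambda>y. \<Prod>i\<in>{..<n}. f (\<pi> i) (y i)) has_sum (\<Prod>i\<in>{..<n}. s i (\<pi> i))) (PiE {..<n} S)"
      by (intro has_sum_prod_PiE) (auto intro: assms)
  qed (auto simp: finite_permutations)
  moreover have "det (mat n n (\<lambda>(p, j). g p j)) =
      (\<Sum>\<pi> \<in> {\<pi>. \<pi> permutes {0..<n}}. signof \<pi> * (\<Prod>i\<in>{..<n}. g i (\<pi> i)))" for g :: "nat \<Rightarrow> nat \<Rightarrow> real"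
    unfolding det_def'[OF mat_carrier]
    by (intro sum.cong arg_cong2[of _ _ _ _ "(*)"] prod.cong)
       (auto simp: atLeast0LessThan dest: permutes_in_image)
  ultimately show ?thesis by simp
qed

section \<open>Alternants and Vandermonde products\<close>

definition vandermonde :: "nat \<Rightarrow> (nat \<Rightarrow> real) \<Rightarrow> real" where
  "vandermonde n x = (\<Prod>j<n. \<Prod>i<j. x i - x j)"

lemma prod_list_diag_mat: "prod_list (diag_mat (mat n n f)) = (\<Prod>i<n. f (i, i))"
  by (simp add: diag_mat_def interv_sum_list_conv_sum_set_nat prod.list_conv_set_nth
      atLeast0LessThan)

text \<open>Expanding the columns in powers factors the matrix into powers times an upper triangular
  coefficient matrix, so only the top coefficients reach the determinant.\<close>

lemma det_graded:
  fixes x :: "nat \<Rightarrow> real" and P :: "nat \<Rightarrow> real poly"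
  assumes "\<And>j. j < n \<Longrightarrow> degree (P j) \<le> j"
  shows "det (mat n n (\<lambda>(p, j). poly (P j) (x p))) =
    (\<Prod>j<n. coeff (P j) j) * det (mat n n (\<lambda>(p, j). x p ^ j))"
proof -
  let ?C = "mat n n (\<lambda>(k, j). coeff (P j) k)"
  have "mat n n (\<lambda>(p, j). poly (P j) (x p)) = mat n n (\<lambda>(p, j). x p ^ j) * ?C"
  proof (rule eq_matI, goal_cases)
    case (1 p j)
    have "poly (P j) (x p) = (\<Sum>k\<le>degree (P j). coeff (P j) k * x p ^ k)"
      by (rule poly_altdef)
    also have "\<dots> = (\<Sum>k<n. coeff (P j) k * x p ^ k)"
      using assms[of j] 1 by (intro sum.mono_neutral_left) (auto simp: coeff_eq_0)
    finally show ?case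
      using 1 by (simp add: scalar_prod_def atLeast0LessThan mult.commute)
  qed auto
  moreover have "det ?C = (\<Prod>j<n. coeff (P j) j)"
  proof -
    have "upper_triangular ?C"
    proof (rule upper_triangularI)
      fix i j assume "j < i" "i < dim_row ?C"
      then show "?C $$ (i, j) = 0"
        using assms[of j] by (auto intro!: coeff_eq_0)
    qed
    then show ?thesis
      by (subst det_upper_triangular) (auto simp: prod_list_diag_mat)
  qed
  ultimately show ?thesis
    by (simp add: det_mult[where n = n] mult.commute)
qed

text \<open>In the Newton basis the alternant matrix is triangular.\<close>

lemma det_powers:
  fixes x :: "nat \<Rightarrow> real"
  shows "det (mat n n (\<lambda>(p, j). x p ^ j)) = (\<Prod>j<n. \<Prod>i<j. x j - x i)"
proof -
  define P where "P j = (\<Prod>i<j. [:- x i, 1:])" for j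
  have deg: "degree (P j) = j" for j
    unfolding P_def by (subst degree_prod_eq_sum_degree) auto
  have "lead_coeff (P j) = 1" for j
    unfolding P_def by (simp add: lead_coeff_prod)
  then have lc: "coeff (P j) j = 1" for j
    using deg by metis
  have "det (mat n n (\<lambda>(p, j). poly (P j) (x p))) = det (mat n n (\<lambda>(p, j). x p ^ j))"
    by (subst det_graded) (auto simp: deg lc)
  moreover have "det (mat n n (\<lambda>(p, j). poly (P j) (x p))) = (\<Prod>j<n. poly (P j) (x j))"
    by (subst det_lower_triangular[where n = n])
       (auto simp: prod_list_diag_mat P_def poly_prod)
  ultimately show ?thesis
    by (simp add: P_def poly_prod)
qed

text \<open>The row weights form a diagonal factor. The signs \<open>(-1) ^ j\<close> come from the
  orientation of \<open>vandermonde\<close>, which is positive for decreasing \<open>x\<close>, the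
  case \<open>x p = q ^ l p\<close> with increasing \<open>l\<close>.\<close>

lemma det_alternant:
  fixes x w :: "nat \<Rightarrow> real" and P :: "nat \<Rightarrow> real poly"
  assumes "\<And>j. j < n \<Longrightarrow> degree (P j) \<le> j"
  shows "det (mat n n (\<lambda>(p, j). w p * poly (P j) (x p))) =
    (\<Prod>p<n. w p) * (\<Prod>j<n. (-1) ^ j * coeff (P j) j) * vandermonde n x"
proof -
  let ?W = "mat n n (\<lambda>(p, j). if p = j then w p else 0)"
  have "mat n n (\<lambda>(p, j). w p * poly (P j) (x p)) = ?W * mat n n (\<lambda>(p, j). poly (P j) (x p))"
    by (rule eq_matI) (auto simp: scalar_prod_def if_distrib[of "\<lambda>u. u * _"] sum.delta cong: if_cong)
  moreover have "det ?W = (\<Prod>p<n. w p)"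
    by (subst det_lower_triangular[where n = n]) (auto simp: prod_list_diag_mat)
  moreover have "(\<Prod>j<n. \<Prod>i<j. x j - x i) = (\<Prod>j<n. (-1) ^ j) * vandermonde n x"
  proof -
    have "(\<Prod>i<j. x j - x i) = (-1) ^ j * (\<Prod>i<j. x i - x j)" for j
    proof -
      have "(\<Prod>i<j. x j - x i) = (\<Prod>i<j. - 1 * (x i - x j))"
        by (intro prod.cong) auto
      then show ?thesis by (simp only: prod.distrib) simp
    qed
    then show ?thesis by (simp add: vandermonde_def prod.distrib)
  qed
  ultimately show ?thesis
    by (simp add: det_mult[where n = n] det_graded[OF assms] det_powers prod.distrib)
qed

text \<open>Isolating the first variable is what lets an extra knot become an extra variable when a
  diagonal loses a cell.\<close>

lemma vandermonde_Suc_shift: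
  "vandermonde (Suc n) x = (\<Prod>p<n. x 0 - x (Suc p)) * vandermonde n (\<lambda>p. x (Suc p))"
  unfolding vandermonde_def
  by (simp add: prod.lessThan_Suc_shift prod.distrib del: prod.lessThan_Suc)

lemma vandermonde_scale: "vandermonde n (\<lambda>p. c * x p) = c ^ (n choose 2) * vandermonde n x"
proof -
  have "(\<Prod>i<j. c * x i - c * x j) = c ^ j * (\<Prod>i<j. x i - x j)" for j
    by (simp flip: right_diff_distrib add: prod.distrib)
  moreover have "(\<Prod>j<n. c ^ j) = c ^ (n choose 2)"
    by (simp add: power_sum[symmetric] choose_two atLeast0LessThan[symmetric] Sum_Ico_nat)
  ultimately show ?thesis
    by (simp add: vandermonde_def prod.distrib)
qed

section \<open>Alternants summed over intervals between knots\<close>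

lemma has_sum_interval_of_tails:
  fixes f :: "nat \<Rightarrow> real"
  assumes "\<And>a. (f has_sum H a) {a..}" and "a \<le> b"
  shows "(f has_sum H a - H b) {a..<b}"
proof -
  have "(f has_sum sum f {a..<b} + H b) ({a..<b} \<union> {b..})"
    by (intro has_sum_Un_disjoint has_sum_finite assms) auto
  also have "{a..<b} \<union> {b..} = {a..}"
    using \<open>a \<le> b\<close> by auto
  finally have "sum f {a..<b} + H b = H a"
    using assms(1) has_sum_unique by blast
  then show ?thesis by (intro has_sum_finiteI) auto
qed

text \<open>Row operations turn the increments of the antidifferences into their values at the knots.\<close>

lemma has_sum_det_interlacing_unbounded:
  fixes f :: "nat \<Rightarrow> nat \<Rightarrow> real"
  assumes tails: "\<And>j a. j < Suc n \<Longrightarrow> (f j has_sum H j a) {a..}"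
    and mono: "\<And>p. p < n \<Longrightarrow> t p \<le> t (Suc p)"
  shows "((\<lambda>y. det (mat (Suc n) (Suc n) (\<lambda>(p, j). f j (y p)))) has_sum
      det (mat (Suc n) (Suc n) (\<lambda>(p, j). H j (t p))))
    (PiE {..<Suc n} (\<lambda>p. if p < n then {t p..<t (Suc p)} else {t p..}))"
proof -
  let ?s = "\<lambda>p j. if p < n then H j (t p) - H j (t (Suc p)) else H j (t p)"
  let ?E = "mat (Suc n) (Suc n) (\<lambda>(p, k). if p = k then 1 else if k = Suc p then - 1 else 0 :: real)"
  have "mat (Suc n) (Suc n) (\<lambda>(p, j). ?s p j) = ?E * mat (Suc n) (Suc n) (\<lambda>(p, j). H j (t p))"
  proof (rule eq_matI, goal_cases)
    case (1 p j)
    have "(\<Sum>k<Suc n. (if p = k then 1 else if k = Suc p then - 1 else 0) * H j (t k))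
      = (\<Sum>k<Suc n. (if k = p then H j (t k) else 0) + (if k = Suc p then - H j (t k) else 0))"
      by (intro sum.cong) auto
    also have "\<dots> = ?s p j"
      using 1 by (auto simp: sum.distrib sum.delta simp del: sum.lessThan_Suc)
    finally show ?case
      using 1 by (simp add: scalar_prod_def atLeast0LessThan del: sum.lessThan_Suc)
  qed auto
  moreover have "det ?E = 1"
    by (subst det_upper_triangular)
       (auto simp: upper_triangular_def prod_list_diag_mat simp del: prod.lessThan_Suc)
  ultimately have "det (mat (Suc n) (Suc n) (\<lambda>(p, j). ?s p j)) =
      det (mat (Suc n) (Suc n) (\<lambda>(p, j). H j (t p)))"
    by (simp add: det_mult[where n = "Suc n"])
  moreover have "((\<lambda>y. det (mat (Suc n) (Suc n) (\<lambda>(p, j). f j (y p)))) has_sum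
      det (mat (Suc n) (Suc n) (\<lambda>(p, j). ?s p j)))
    (PiE {..<Suc n} (\<lambda>p. if p < n then {t p..<t (Suc p)} else {t p..}))"
    using mono by (intro has_sum_det_rows) (auto intro!: has_sum_interval_of_tails tails)
  ultimately show ?thesis by simp
qed

text \<open>All intervals are finite and increments are taken against the knot below. Normalising
  the antidifference to 0 at the lowest knot turns the first increment into a value, and row
  operations with the lower bidiagonal \<open>?E\<close> do the rest. The second argument of
  \<open>H\<close> is the index of a knot, not the knot.\<close>

lemma has_sum_det_interlacing_bounded:
  fixes f :: "nat \<Rightarrow> nat \<Rightarrow> real"
  assumes sums: "\<And>p j. p < n \<Longrightarrow> j < n \<Longrightarrow> (\<Sum>a\<in>{t p..<t (Suc p)}. f j a) = H j (Suc p) - H j p"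
    and zero: "\<And>j. j < n \<Longrightarrow> H j 0 = 0"
  shows "((\<lambda>y. det (mat n n (\<lambda>(p, j). f j (y p)))) has_sum det (mat n n (\<lambda>(p, j). H j (Suc p))))
    (PiE {..<n} (\<lambda>p. {t p..<t (Suc p)}))"
proof -
  let ?E = "mat n n (\<lambda>(p, k). if p = k then 1 else if p = Suc k then - 1 else 0 :: real)"
  have "mat n n (\<lambda>(p, j). H j (Suc p) - H j p) = ?E * mat n n (\<lambda>(p, j). H j (Suc p))"
  proof (rule eq_matI, goal_cases)
    case (1 p j)
    have "(\<Sum>k<n. (if p = k then 1 else if p = Suc k then - 1 else 0) * H j (Suc k))
      = (\<Sum>k<n. (if k = p then H j (Suc k) else 0) + (if p = Suc k then - H j (Suc k) else 0))"
      by (intro sum.cong) auto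
    also have "\<dots> = H j (Suc p) + (\<Sum>k<n. (if p = Suc k then - H j (Suc k) else 0))"
      using 1 by (simp add: sum.distrib sum.delta)
    also have "(\<Sum>k<n. (if p = Suc k then - H j (Suc k) else 0)) = - H j p"
    proof (cases p)
      case 0
      then show ?thesis using zero[of j] 1 by simp
    next
      case (Suc p')
      then have "(\<Sum>k<n. (if p = Suc k then - H j (Suc k) else 0)) = (\<Sum>k<n. (if k = p' then - H j (Suc k) else 0))"
        by (intro sum.cong) auto
      then show ?thesis using Suc 1 by (simp add: sum.delta)
    qed
    finally show ?case
      using 1 by (simp add: scalar_prod_def atLeast0LessThan)
  qed auto
  moreover have "det ?E = 1"
    by (subst det_lower_triangular[where n = n]) (auto simp: prod_list_diag_mat)
  ultimately have "det (mat n n (\<lambda>(p, j). H j (Suc p) - H j p)) = det (mat n n (\<lambda>(p, j). H j (Suc p)))"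
    by (simp add: det_mult[where n = n])
  moreover have "((\<lambda>y. det (mat n n (\<lambda>(p, j). f j (y p)))) has_sum
      det (mat n n (\<lambda>(p, j). H j (Suc p) - H j p))) (PiE {..<n} (\<lambda>p. {t p..<t (Suc p)}))"
    using sums by (intro has_sum_det_rows) (simp add: has_sum_finite_iff)
  ultimately show ?thesis by simp
qed


section \<open>The weight of a page with prescribed diagonal\<close>

lemma q_poch_Suc: "q_poch x q (Suc s) = q_poch x q s * (1 - x * q ^ s)"
  by (simp add: q_poch_def)

text \<open>The exposed factor \<open>1 - x\<close> is zero at \<open>x = q ^ 0\<close>, which makes
  antidifferences vanish at the knot 0.\<close>

lemma q_poch_Suc_left: "q_poch x q (Suc s) = (1 - x) * q_poch (q * x) q s"
  by (simp add: q_poch_def prod.lessThan_Suc_shift algebra_simps del: prod.lessThan_Suc)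

lemma q_poch_q_add: "q_poch q q (m + n) = q_poch q q m * (\<Prod>j<n. 1 - q ^ (m + 1 + j))"
  by (induction n) (simp_all add: q_poch_Suc algebra_simps power_add)

lemma q_poch_bounds:
  assumes "0 < q" "q < 1" "0 \<le> x" "x \<le> 1"
  shows "0 \<le> q_poch x q s" "q_poch x q s \<le> 1"
proof -
  have "x * q ^ i \<le> 1" for i
    using assms by (intro mult_le_one) (auto intro: power_le_one)
  then show "0 \<le> q_poch x q s" "q_poch x q s \<le> 1"
    using assms unfolding q_poch_def by (auto intro!: prod_nonneg prod_le_1)
qed

lemma q_poch_q_pos:
  assumes "0 < q" "q < 1"
  shows "q_poch q q s > 0"
  using assms power_Suc_less_one unfolding q_poch_def by (intro prod_pos) force

lemma one_minus_power_pos: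
  fixes q :: real
  assumes "0 < q" "q < 1" "k > 0"
  shows "1 - q ^ k > 0"
  using assms by (simp add: power_less_one_iff)

text \<open>Equals \<open>(1 - q) ^ (l choose 2)\<close> times the \<open>q\<close>-superfactorial;
  clearing denominators keeps powers of \<open>1 - q\<close> out of the page recursion.\<close>

definition q_poch_superfact :: "real \<Rightarrow> nat \<Rightarrow> real" where
  "q_poch_superfact q l = (\<Prod>i<l. q_poch q q i)"

lemma q_poch_superfact_Suc:
  "q_poch_superfact q (Suc l) = q_poch_superfact q l * q_poch q q l"
  by (simp add: q_poch_superfact_def)

lemma q_poch_superfact_pos:
  assumes "0 < q" "q < 1"
  shows "q_poch_superfact q l > 0"
  unfolding q_poch_superfact_def by (intro prod_pos) (auto intro: q_poch_q_pos assms)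

text \<open>For \<open>n = 0\<close> this is MacMahon's generating function of plane partitions in
  an \<open>a\<close> by \<open>b\<close> rectangle. The power of \<open>q\<close> is the lowest one
  occurring in the other factors of \<open>page_weight\<close> at \<open>l p = p\<close>, which
  encodes the all-zero diagonal.\<close>

definition page_const :: "real \<Rightarrow> nat \<Rightarrow> nat \<Rightarrow> nat \<Rightarrow> real" where
  "page_const q n a b = q_poch_superfact q a * q_poch_superfact q b /
     (q_poch_superfact q (n + a + b) * q ^ (a * (n choose 2) + (n choose 3)))"

text \<open>The generating function of the off-diagonal fillings of a page whose diagonal entries,
  read from bottom to top, are \<open>l p - p\<close>.\<close>

definition page_weight :: "real \<Rightarrow> nat \<Rightarrow> nat \<Rightarrow> nat \<Rightarrow> (nat \<Rightarrow> nat) \<Rightarrow> real" where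
  "page_weight q n a b l = page_const q n a b *
     (\<Prod>p<n. (q ^ l p) ^ a * q_poch (q * q ^ l p) q b) * vandermonde n (\<lambda>p. q ^ l p)"

text \<open>Converts a summed alternant of adapted polynomials back into a sum of weight times
  Vandermonde product; \<open>c\<close> gathers the leading coefficients and the orientation
  signs.\<close>

lemma has_sum_weighted_vandermonde:
  assumes sum: "((\<lambda>y. det (mat n n (\<lambda>(p, j). w (y p) * poly (P j) (q ^ y p)))) has_sum D) A"
    and deg: "\<And>j. j < n \<Longrightarrow> degree (P j) \<le> j"
    and c: "(\<Prod>j<n. (-1) ^ j * coeff (P j) j) = c" "c \<noteq> 0"
  shows "((\<lambda>y. (\<Prod>p<n. w (y p)) * vandermonde n (\<lambda>p. q ^ y p)) has_sum D / c) A"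
proof -
  have "det (mat n n (\<lambda>(p, j). w (y p) * poly (P j) (q ^ y p))) =
      c * ((\<Prod>p<n. w (y p)) * vandermonde n (\<lambda>p. q ^ y p))" for y
    using det_alternant[of n P "\<lambda>p. w (y p)" "\<lambda>p. q ^ y p", OF deg] c by (simp add: mult_ac)
  with sum have "((\<lambda>y. c * ((\<Prod>p<n. w (y p)) * vandermonde n (\<lambda>p. q ^ y p))) has_sum D) A"
    by simp
  from has_sum_cmult_right[OF this, of "inverse c"] show ?thesis
    using \<open>c \<noteq> 0\<close> by (simp add: field_simps)
qed

text \<open>The geometric bound serves twice: it sends the boundary term to 0, and it gives the
  absolute convergence that unordered summation demands.\<close>

lemma has_sum_telescope_tail:
  fixes H :: "nat \<Rightarrow> real"
  assumes q: "0 < q" "q < 1" and H: "\<And>t. \<bar>H t\<bar> \<le> q ^ t"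
  shows "((\<lambda>t. H t - H (Suc t)) has_sum H a) {a..}"
proof -
  have lim: "H \<longlonglongrightarrow> 0"
  proof (rule Lim_null_comparison)
    show "\<forall>\<^sub>F t in sequentially. norm (H t) \<le> q ^ t"
      using H by simp
    show "(\<lambda>t. q ^ t) \<longlonglongrightarrow> 0"
      using q by (intro LIMSEQ_power_zero) auto
  qed
  have "summable (\<lambda>t. 2 * q ^ (t + a))"
    using q by (intro summable_mult summable_ignore_initial_segment summable_geometric) auto
  then have "summable (\<lambda>t. norm (H (t + a) - H (Suc (t + a))))"
  proof (rule summable_comparison_test[rotated], intro exI[of _ 0] allI impI)
    fix t
    have "q ^ Suc (t + a) \<le> q ^ (t + a)"
      using q by (intro power_decreasing) auto
    then show "norm (norm (H (t + a) - H (Suc (t + a)))) \<le> 2 * q ^ (t + a)"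
      using H[of "t + a"] H[of "Suc (t + a)"] by simp
  qed
  moreover have "(\<lambda>t. H (t + a) - H (Suc (t + a))) sums (H a - 0)"
    using telescope_sums'[OF LIMSEQ_ignore_initial_segment[OF lim, of a]] by simp
  ultimately have "((\<lambda>t. H (t + a) - H (Suc (t + a))) has_sum H a) UNIV"
    by (intro norm_summable_imp_has_sum) simp_all
  also have "?this \<longleftrightarrow> ?thesis"
    by (rule has_sum_reindex_bij_witness[of _ "\<lambda>t. t - a" "\<lambda>t. t + a"]) auto
  finally show ?thesis .
qed

text \<open>Up to a factor \<open>1 - q\<close> this is the \<open>q\<close>-beta integral.
  Multiplying out the last factor of the longer Pochhammer product expresses the value for
  \<open>Suc b\<close> by those for \<open>b\<close> at \<open>a\<close> and \<open>Suc a\<close>,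
  hence the generalisation over \<open>a\<close>.\<close>

lemma has_sum_q_beta:
  assumes q: "0 < q" "q < 1"
  shows "((\<lambda>t. (q ^ t) ^ Suc a * q_poch (q * q ^ t) q b) has_sum
    q_poch q q a * q_poch q q b / q_poch q q (Suc (a + b))) UNIV"
proof (induction b arbitrary: a)
  case 0
  have "q ^ Suc a < 1"
    using q by (intro power_Suc_less_one) auto
  then have "(\<lambda>t. (q ^ Suc a) ^ t) sums (1 / (1 - q ^ Suc a))"
    using q by (intro geometric_sums) (auto simp: abs_mult power_abs)
  then have "((\<lambda>t. (q ^ Suc a) ^ t) has_sum (1 / (1 - q ^ Suc a))) UNIV"
    using q by (intro sums_nonneg_imp_has_sum) auto
  moreover have "1 / (1 - q ^ Suc a) = q_poch q q a * q_poch q q 0 / q_poch q q (Suc (a + 0))"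
    using q_poch_q_pos[OF q, of a] by (simp add: q_poch_Suc) (simp add: q_poch_def)
  moreover have "(q ^ Suc a) ^ t = (q ^ t) ^ Suc a * q_poch (q * q ^ t) q 0" for t
    by (simp add: q_poch_def power_mult[symmetric] power_add[symmetric] algebra_simps)
  ultimately show ?case by (simp only:)
next
  case (Suc b)
  let ?B = "\<lambda>a. q_poch q q a * q_poch q q b / q_poch q q (Suc (a + b))"
  have "((\<lambda>t. (q ^ t) ^ Suc a * q_poch (q * q ^ t) q b
      + - (q ^ Suc b) * ((q ^ t) ^ Suc (Suc a) * q_poch (q * q ^ t) q b)) has_sum
      ?B a + - (q ^ Suc b) * ?B (Suc a)) UNIV"
    by (intro has_sum_add has_sum_cmult_right Suc.IH)
  moreover have "(q ^ t) ^ Suc a * q_poch (q * q ^ t) q b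
      + - (q ^ Suc b) * ((q ^ t) ^ Suc (Suc a) * q_poch (q * q ^ t) q b)
      = (q ^ t) ^ Suc a * q_poch (q * q ^ t) q (Suc b)" for t
    by (simp add: q_poch_Suc algebra_simps)
  moreover have "?B a + - (q ^ Suc b) * ?B (Suc a)
      = q_poch q q a * q_poch q q (Suc b) / q_poch q q (Suc (a + Suc b))"
  proof -
    define X where "X = q_poch q q (Suc (a + b))"
    have X: "X > 0" unfolding X_def by (rule q_poch_q_pos[OF q])
    have Y: "1 - q ^ (a + b + 2) > 0"
      by (rule one_minus_power_pos) (use q in auto)
    have "q_poch q q (Suc (Suc (a + b))) = X * (1 - q ^ (a + b + 2))"
      by (simp add: X_def q_poch_Suc[of q q "Suc (a + b)"])
    then show ?thesis
      using X Y unfolding X_def[symmetric] add_Suc add_Suc_right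
      by (simp add: q_poch_Suc X_def[symmetric] divide_simps)
         (simp add: algebra_simps power_add)
  qed
  ultimately show ?case by (simp only:)
qed

section \<open>The four ways of passing to the next diagonal\<close>

text \<open>In the next two proofs \<open>HH j\<close> is an antidifference of the \<open>j\<close>th column that vanishes
  at the lowest knot.\<close>

lemma page_weight_step_col:
  assumes q: "0 < q" "q < 1" and l: "\<And>p. Suc p < n \<Longrightarrow> l p < l (Suc p)"
  shows "((\<lambda>y. (\<Prod>p<n. q ^ y p) * page_weight q n 0 b y) has_sum
      q ^ (n choose 2) * page_weight q n 0 (Suc b) l)
    (PiE {..<n} (\<lambda>p. {(case p of 0 \<Rightarrow> 0 | Suc p' \<Rightarrow> Suc (l p'))..<Suc (l p)}))"
proof -
  \<comment> \<open>Shifting the knots by one makes the ranges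
    \<open>l (p - 1) < y \<le> l p\<close> half-open; the extra knot 0 is the natural lower bound,
    where \<open>HH\<close> vanishes through the factor \<open>1 - q ^ 0\<close>.\<close>
  define t where "t = (\<lambda>p. case p of 0 \<Rightarrow> 0 | Suc p' \<Rightarrow> Suc (l p'))"
  define w where "w = (\<lambda>s. q ^ s * q_poch (q * q ^ s) q b)"
  \<comment> \<open>The increment of \<open>HH j\<close> divided by \<open>w\<close>. At
    \<open>j = 0\<close> the truncated exponent \<open>j - 1\<close> is harmless, because its
    coefficient contains \<open>q ^ 0 - 1\<close>.\<close>
  define P where "P = (\<lambda>j. monom ((-1) ^ j * (1 - q ^ (b + 1 + j))) j + monom ((-1) ^ j * (q ^ j - 1)) (j - 1))"
  define HH where "HH = (\<lambda>j s. q_poch (q ^ s) q (Suc b) * (- (q ^ s)) ^ j)"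
  let ?A = "PiE {..<n} (\<lambda>p. {t p..<t (Suc p)})"
  have t_mono: "t p \<le> t (Suc p)" if "p < n" for p
    using that l by (cases p) (auto simp: t_def less_imp_le)
  have f: "w s * poly (P j) (q ^ s) = HH j (Suc s) - HH j s" for s j
  proof -
    have p1: "q_poch (q ^ s) q (Suc b) = (1 - q ^ s) * q_poch (q * q ^ s) q b"
      by (rule q_poch_Suc_left)
    have p2: "q_poch (q * q ^ s) q (Suc b) = q_poch (q * q ^ s) q b * (1 - q * q ^ s * q ^ b)"
      by (rule q_poch_Suc)
    have p3: "q ^ s * poly (P j) (q ^ s) =
      (1 - q * q ^ s * q ^ b) * (- (q * q ^ s)) ^ j - (1 - q ^ s) * (- (q ^ s)) ^ j"
    proof -
      have eqs: "(- (q ^ s)) ^ j = (-1) ^ j * (q ^ s) ^ j" "(- (q * q ^ s)) ^ j = (-1) ^ j * (q ^ j * (q ^ s) ^ j)"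
        by (simp_all add: power_minus[of "q ^ s"] power_minus[of "q * q ^ s"] power_mult_distrib)
      show ?thesis
        unfolding eqs by (cases j) (simp_all add: P_def poly_monom algebra_simps power_add)
    qed
    have "w s * poly (P j) (q ^ s) = q_poch (q * q ^ s) q b * (q ^ s * poly (P j) (q ^ s))"
      by (simp add: w_def)
    also have "\<dots> = HH j (Suc s) - HH j s"
      unfolding p3 HH_def power_Suc[of q s] p1 p2 by (simp add: algebra_simps)
    finally show ?thesis .
  qed
  have "((\<lambda>y. det (mat n n (\<lambda>(p, j). w (y p) * poly (P j) (q ^ y p)))) has_sum
      det (mat n n (\<lambda>(p, j). HH j (t (Suc p))))) ?A"
  proof (rule has_sum_det_interlacing_bounded)
    show "(\<Sum>a = t p..<t (Suc p). w a * poly (P j) (q ^ a)) = HH j (t (Suc p)) - HH j (t p)"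
      if "p < n" for p j
      unfolding f by (rule sum_Suc_diff'[OF t_mono[OF that]])
    show "HH j (t 0) = 0" for j
      by (simp add: HH_def t_def q_poch_Suc_left)
  qed
  then have "((\<lambda>y. (\<Prod>p<n. w (y p)) * vandermonde n (\<lambda>p. q ^ y p)) has_sum
     det (mat n n (\<lambda>(p, j). HH j (t (Suc p)))) / (\<Prod>j<n. 1 - q ^ (b + 1 + j))) ?A"
  proof (rule has_sum_weighted_vandermonde)
    show "degree (P j) \<le> j" for j
      unfolding P_def by (intro degree_add_le degree_monom_le order.trans[OF degree_monom_le]) auto
    show "(\<Prod>j<n. (-1) ^ j * coeff (P j) j) = (\<Prod>j<n. 1 - q ^ (b + 1 + j))"
    proof (rule prod.cong)
      show "(-1) ^ j * coeff (P j) j = 1 - q ^ (b + 1 + j)" for j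
        by (cases j) (auto simp: P_def algebra_simps simp flip: power_mult_distrib)
    qed simp
    show "(\<Prod>j<n. 1 - q ^ (b + 1 + j)) \<noteq> 0"
      by (intro less_imp_neq[symmetric] prod_pos one_minus_power_pos[OF q] ballI) auto
  qed
  from has_sum_cmult_right[OF this, of "page_const q n 0 b"]
  have S: "((\<lambda>y. (\<Prod>p<n. q ^ y p) * page_weight q n 0 b y) has_sum
     page_const q n 0 b * (det (mat n n (\<lambda>(p, j). HH j (t (Suc p)))) / (\<Prod>j<n. 1 - q ^ (b + 1 + j)))) ?A"
    by (simp add: page_weight_def w_def prod.distrib mult_ac)
  have D: "det (mat n n (\<lambda>(p, j). HH j (t (Suc p)))) =
      (\<Prod>p<n. q_poch (q * q ^ l p) q (Suc b)) * (q ^ (n choose 2) * vandermonde n (\<lambda>p. q ^ l p))"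
  proof -
    \<comment> \<open>The values are taken at \<open>Suc (l p)\<close>, so the variables are
      \<open>q * q ^ l p\<close>; pulling \<open>q\<close> out of the Vandermonde product yields the
      exponent \<open>n choose 2\<close>.\<close>
    have "det (mat n n (\<lambda>(p, j). HH j (t (Suc p)))) =
      det (mat n n (\<lambda>(p, j). q_poch (q * q ^ l p) q (Suc b) * poly (monom ((-1) ^ j) j) (q * q ^ l p)))"
      by (intro arg_cong[of _ _ det] eq_matI)
         (auto simp: HH_def t_def poly_monom power_minus[of "q * q ^ _"])
    also have "\<dots> = (\<Prod>p<n. q_poch (q * q ^ l p) q (Suc b)) * vandermonde n (\<lambda>p. q * q ^ l p)"
      by (subst det_alternant[OF degree_monom_le]) (simp flip: power_mult_distrib)
    finally show ?thesis by (simp add: vandermonde_scale)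
  qed
  \<comment> \<open>The leading coefficients multiply to
    \<open>q_poch q q (b + n) / q_poch q q b\<close>, the ratio of the page constants for
    \<open>b\<close> and \<open>Suc b\<close>.\<close>
  have K: "page_const q n 0 b / (\<Prod>j<n. 1 - q ^ (b + 1 + j)) = page_const q n 0 (Suc b)"
    using q_poch_q_pos[OF q, of b] q_poch_q_add[of q b n]
    by (simp add: page_const_def q_poch_superfact_Suc add.commute[of n b])
  have "page_const q n 0 b * (det (mat n n (\<lambda>(p, j). HH j (t (Suc p)))) / (\<Prod>j<n. 1 - q ^ (b + 1 + j))) = q ^ (n choose 2) * page_weight q n 0 (Suc b) l"
  proof -
    have "page_const q n 0 b * (det (mat n n (\<lambda>(p, j). HH j (t (Suc p)))) / (\<Prod>j<n. 1 - q ^ (b + 1 + j))) = page_const q n 0 b / (\<Prod>j<n. 1 - q ^ (b + 1 + j)) * det (mat n n (\<lambda>(p, j). HH j (t (Suc p))))"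
      by simp
    then show ?thesis
      unfolding K D by (simp add: page_weight_def mult_ac)
  qed
  with S show ?thesis
    by (simp only: t_def nat.case)
qed

text \<open>With \<open>n\<close> intervals between \<open>n + 1\<close> given knots, no Pochhammer
  factor vanishes at the lowest one. Building the factor \<open>x0 - q ^ s\<close> into the
  antidifference makes it zero there and at the same time completes the Vandermonde product to
  \<open>n + 1\<close> variables.\<close>

lemma page_weight_step_shrink:
  assumes q: "0 < q" "q < 1" and l: "\<And>p. p < n \<Longrightarrow> l p < l (Suc p)"
  shows "((\<lambda>y. (\<Prod>p<n. q ^ y p) * page_weight q n 0 0 y) has_sum
      q ^ (n choose 2) * page_weight q (Suc n) 0 0 l)
    (PiE {..<n} (\<lambda>p. {l p..<l (Suc p)}))"
proof -
  define x0 where "x0 = q ^ l 0"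
  define P where "P = (\<lambda>j. monom ((-1) ^ j * (1 - q ^ (1 + j))) j + monom ((-1) ^ j * (q ^ j - 1) * x0) (j - 1))"
  define HH where "HH = (\<lambda>j s. (x0 - q ^ s) * (- (q ^ s)) ^ j)"
  let ?A = "PiE {..<n} (\<lambda>p. {l p..<l (Suc p)})"
  have f: "q ^ s * poly (P j) (q ^ s) = HH j (Suc s) - HH j s" for s j
  proof -
    have eqs: "(- (q ^ s)) ^ j = (-1) ^ j * (q ^ s) ^ j" "(- (q * q ^ s)) ^ j = (-1) ^ j * (q ^ j * (q ^ s) ^ j)"
      by (simp_all add: power_minus[of "q ^ s"] power_minus[of "q * q ^ s"] power_mult_distrib)
    show ?thesis
      unfolding HH_def power_Suc[of q s] eqs
      by (cases j) (simp_all add: P_def poly_monom algebra_simps power_add)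
  qed
  have "((\<lambda>y. det (mat n n (\<lambda>(p, j). q ^ y p * poly (P j) (q ^ y p)))) has_sum
      det (mat n n (\<lambda>(p, j). HH j (l (Suc p))))) ?A"
  proof (rule has_sum_det_interlacing_bounded)
    show "(\<Sum>a = l p..<l (Suc p). q ^ a * poly (P j) (q ^ a)) = HH j (l (Suc p)) - HH j (l p)"
      if "p < n" for p j
      unfolding f by (rule sum_Suc_diff'[OF less_imp_le[OF l[OF that]]])
    show "HH j (l 0) = 0" for j
      by (simp add: HH_def x0_def)
  qed
  then have "((\<lambda>y. (\<Prod>p<n. q ^ y p) * vandermonde n (\<lambda>p. q ^ y p)) has_sum
     det (mat n n (\<lambda>(p, j). HH j (l (Suc p)))) / q_poch q q n) ?A"
  proof (rule has_sum_weighted_vandermonde)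
    show "degree (P j) \<le> j" for j
      unfolding P_def by (intro degree_add_le degree_monom_le order.trans[OF degree_monom_le]) auto
    show "(\<Prod>j<n. (-1) ^ j * coeff (P j) j) = q_poch q q n"
      unfolding q_poch_def
    proof (rule prod.cong)
      show "(-1) ^ j * coeff (P j) j = 1 - q * q ^ j" for j
        by (cases j) (auto simp: P_def algebra_simps simp flip: power_mult_distrib)
    qed simp
    show "q_poch q q n \<noteq> 0"
      using q_poch_q_pos[OF q, of n] by simp
  qed
  from has_sum_cmult_right[OF this, of "page_const q n 0 0"]
  have S: "((\<lambda>y. (\<Prod>p<n. q ^ y p) * page_weight q n 0 0 y) has_sum
     page_const q n 0 0 * (det (mat n n (\<lambda>(p, j). HH j (l (Suc p)))) / q_poch q q n)) ?A"
    by (simp add: page_weight_def q_poch_def mult_ac)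
  have D: "det (mat n n (\<lambda>(p, j). HH j (l (Suc p)))) = vandermonde (Suc n) (\<lambda>p. q ^ l p)"
  proof -
    have "det (mat n n (\<lambda>(p, j). HH j (l (Suc p)))) =
      det (mat n n (\<lambda>(p, j). (x0 - q ^ l (Suc p)) * poly (monom ((-1) ^ j) j) (q ^ l (Suc p))))"
      by (intro arg_cong[of _ _ det] eq_matI)
         (auto simp: HH_def poly_monom power_minus[of "q ^ _"])
    also have "\<dots> = (\<Prod>p<n. x0 - q ^ l (Suc p)) * vandermonde n (\<lambda>p. q ^ l (Suc p))"
      by (subst det_alternant[OF degree_monom_le]) (simp flip: power_mult_distrib)
    finally show ?thesis by (simp add: vandermonde_Suc_shift x0_def)
  qed
  \<comment> \<open>Pascal's rule for \<open>Suc n choose 3\<close> accounts for the power of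
    \<open>q\<close>.\<close>
  have K: "page_const q n 0 0 / q_poch q q n = q ^ (n choose 2) * page_const q (Suc n) 0 0"
    using q by (simp add: page_const_def q_poch_superfact_Suc numeral_3_eq_3 numeral_2_eq_2 power_add)
  have "page_const q n 0 0 * (det (mat n n (\<lambda>(p, j). HH j (l (Suc p)))) / q_poch q q n) = q ^ (n choose 2) * page_weight q (Suc n) 0 0 l"
  proof -
    have "page_const q n 0 0 * (det (mat n n (\<lambda>(p, j). HH j (l (Suc p)))) / q_poch q q n) = page_const q n 0 0 / q_poch q q n * det (mat n n (\<lambda>(p, j). HH j (l (Suc p))))"
      by simp
    then show ?thesis
      unfolding K D by (simp add: page_weight_def q_poch_def mult_ac)
  qed
  with S show ?thesis
    by (simp only:)
qed

text \<open>Powers of \<open>q ^ s\<close> are their own antidifferences up to a constant and decay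
  at infinity, so the columns can be expressed by tails. This fits the last interval, unbounded
  because the diagonal gains a cell on top.\<close>

lemma page_weight_step_row:
  assumes q: "0 < q" "q < 1" and l: "\<And>p. p < n \<Longrightarrow> l p < l (Suc p)"
  shows "((\<lambda>y. (\<Prod>p<Suc n. q ^ y p) * page_weight q (Suc n) a 0 y) has_sum
      q ^ (Suc n choose 2) * page_weight q (Suc n) (Suc a) 0 l)
    (PiE {..<Suc n} (\<lambda>p. if p < n then {l p..<l (Suc p)} else {l p..}))"
proof -
  define P where "P = (\<lambda>j. monom ((-1) ^ j * (1 - q ^ (a + 1 + j))) j)"
  define H where "H = (\<lambda>j s. (q ^ s) ^ Suc a * (- (q ^ s)) ^ j)"
  define w where "w = (\<lambda>s. (q ^ s) ^ Suc a)"
  let ?A = "PiE {..<Suc n} (\<lambda>p. if p < n then {l p..<l (Suc p)} else {l p..})"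
  have f: "w s * poly (P j) (q ^ s) = H j s - H j (Suc s)" for s j
  proof -
    have eqs: "(- (q ^ s)) ^ j = (-1) ^ j * (q ^ s) ^ j" "(- (q * q ^ s)) ^ j = (-1) ^ j * (q ^ j * (q ^ s) ^ j)"
      by (simp_all add: power_minus[of "q ^ s"] power_minus[of "q * q ^ s"] power_mult_distrib)
    show ?thesis
      unfolding H_def power_Suc[of q s] eqs
      by (simp add: P_def w_def poly_monom algebra_simps power_add power_mult_distrib)
  qed
  have H: "\<bar>H j s\<bar> \<le> q ^ s" for j s
  proof -
    have "\<bar>H j s\<bar> = q ^ s * (q ^ s) ^ (a + j)"
      using q by (simp add: H_def abs_mult power_abs power_add)
    also have "\<dots> \<le> q ^ s * 1"
      using q by (intro mult_left_mono power_le_one) auto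
    finally show ?thesis by simp
  qed
  have "((\<lambda>y. det (mat (Suc n) (Suc n) (\<lambda>(p, j). w (y p) * poly (P j) (q ^ y p)))) has_sum
      det (mat (Suc n) (Suc n) (\<lambda>(p, j). H j (l p)))) ?A"
    using l by (intro has_sum_det_interlacing_unbounded)
               (auto simp: f less_imp_le intro!: has_sum_telescope_tail[OF q] H)
  then have "((\<lambda>y. (\<Prod>p<Suc n. w (y p)) * vandermonde (Suc n) (\<lambda>p. q ^ y p)) has_sum
     det (mat (Suc n) (Suc n) (\<lambda>(p, j). H j (l p))) / (\<Prod>j<Suc n. 1 - q ^ (a + 1 + j))) ?A"
  proof (rule has_sum_weighted_vandermonde)
    show "degree (P j) \<le> j" for j
      unfolding P_def by (rule degree_monom_le)
    show "(\<Prod>j<Suc n. (-1) ^ j * coeff (P j) j) = (\<Prod>j<Suc n. 1 - q ^ (a + 1 + j))"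
      by (rule prod.cong) (auto simp: P_def simp flip: power_mult_distrib mult.assoc)
    show "(\<Prod>j<Suc n. 1 - q ^ (a + 1 + j)) \<noteq> 0"
      by (intro less_imp_neq[symmetric] prod_pos one_minus_power_pos[OF q] ballI) auto
  qed
  from has_sum_cmult_right[OF this, of "page_const q (Suc n) a 0"]
  have S: "((\<lambda>y. (\<Prod>p<Suc n. q ^ y p) * page_weight q (Suc n) a 0 y) has_sum
     page_const q (Suc n) a 0 * (det (mat (Suc n) (Suc n) (\<lambda>(p, j). H j (l p))) / (\<Prod>j<Suc n. 1 - q ^ (a + 1 + j)))) ?A"
    by (simp add: page_weight_def w_def q_poch_def prod.distrib mult_ac del: prod.lessThan_Suc)
  have D: "det (mat (Suc n) (Suc n) (\<lambda>(p, j). H j (l p))) =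
      (\<Prod>p<Suc n. (q ^ l p) ^ Suc a) * vandermonde (Suc n) (\<lambda>p. q ^ l p)"
  proof -
    have "det (mat (Suc n) (Suc n) (\<lambda>(p, j). H j (l p))) =
      det (mat (Suc n) (Suc n) (\<lambda>(p, j). (q ^ l p) ^ Suc a * poly (monom ((-1) ^ j) j) (q ^ l p)))"
      by (intro arg_cong[of _ _ det] eq_matI)
         (auto simp: H_def poly_monom power_minus[of "q ^ _"])
    then show ?thesis
      by (subst (asm) det_alternant[OF degree_monom_le])
         (simp del: prod.lessThan_Suc flip: power_mult_distrib)
  qed
  have K: "page_const q (Suc n) a 0 / (\<Prod>j<Suc n. 1 - q ^ (a + 1 + j)) =
      q ^ (Suc n choose 2) * page_const q (Suc n) (Suc a) 0"
    using q q_poch_q_pos[OF q, of a] q_poch_q_add[of q a "Suc n"]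
    by (simp add: page_const_def q_poch_superfact_Suc add.commute[of n a] power_add
        del: prod.lessThan_Suc)
  have "page_const q (Suc n) a 0 * (det (mat (Suc n) (Suc n) (\<lambda>(p, j). H j (l p))) / (\<Prod>j<Suc n. 1 - q ^ (a + 1 + j))) = q ^ (Suc n choose 2) * page_weight q (Suc n) (Suc a) 0 l"
  proof -
    have "page_const q (Suc n) a 0 * (det (mat (Suc n) (Suc n) (\<lambda>(p, j). H j (l p))) / (\<Prod>j<Suc n. 1 - q ^ (a + 1 + j))) = page_const q (Suc n) a 0 / (\<Prod>j<Suc n. 1 - q ^ (a + 1 + j)) * det (mat (Suc n) (Suc n) (\<lambda>(p, j). H j (l p)))"
      by simp
    then show ?thesis
      unfolding K D by (simp add: page_weight_def q_poch_def mult_ac del: prod.lessThan_Suc binomial_Suc_Suc)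
  qed
  with S show ?thesis
    by (simp only:)
qed

text \<open>There is one more entry than given knots, so not all columns may vanish at the added
  knot 0. Using the constant polynomial in one column leaves a plain sum of \<open>w\<close>, and
  the expansion along the first row needs it only over all natural numbers.\<close>

lemma page_weight_step_grow:
  assumes q: "0 < q" "q < 1" and l: "\<And>p. Suc p < n \<Longrightarrow> l p < l (Suc p)"
  shows "((\<lambda>y. (\<Prod>p<Suc n. q ^ y p) * page_weight q (Suc n) a b y) has_sum
      q ^ (Suc n choose 2) * page_weight q n (Suc a) (Suc b) l)
    (PiE {..<Suc n} (\<lambda>p. if p < n then {(case p of 0 \<Rightarrow> 0 | Suc p' \<Rightarrow> Suc (l p'))..<Suc (l p)}
       else {(case p of 0 \<Rightarrow> 0 | Suc p' \<Rightarrow> Suc (l p'))..}))"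
proof -
  define t where "t = (\<lambda>p. case p of 0 \<Rightarrow> 0 | Suc p' \<Rightarrow> Suc (l p'))"
  define w where "w = (\<lambda>s. (q ^ s) ^ Suc a * q_poch (q * q ^ s) q b)"
  \<comment> \<open>For \<open>Suc i\<close> this is the decrement of \<open>G i\<close> divided by
    \<open>w\<close>.\<close>
  define P where "P = (\<lambda>j. case j of 0 \<Rightarrow> 1 | Suc i \<Rightarrow>
     monom ((-1) ^ Suc i * (1 - q ^ (a + b + 2 + i))) (Suc i) + monom ((-1) ^ i * (1 - q ^ (a + 1 + i))) i)"
  define G where "G = (\<lambda>i s. (q ^ s) ^ Suc a * q_poch (q ^ s) q (Suc b) * (- (q ^ s)) ^ i)"
  define H where "H = (\<lambda>j. case j of 0 \<Rightarrow> \<lambda>s. infsum w {s..} | Suc i \<Rightarrow> G i)"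
  \<comment> \<open>The columns \<open>H (Suc i)\<close> vanish at the lowest knot, so only the \<open>q\<close>-beta integral
    \<open>H 0 0\<close> survives in the first row of the determinant.\<close>
  let ?A = "PiE {..<Suc n} (\<lambda>p. if p < n then {t p..<t (Suc p)} else {t p..})"
  let ?c = "\<Prod>j<n. 1 - q ^ (a + b + 1 + 1 + j)"
  let ?B = "q_poch q q a * q_poch q q b / q_poch q q (Suc (a + b))"
  have t_mono: "t p \<le> t (Suc p)" if "p < n" for p
    using that l by (cases p) (auto simp: t_def less_imp_le)
  have f: "w s * poly (P (Suc i)) (q ^ s) = G i s - G i (Suc s)" for s i
  proof -
    have p1: "q_poch (q ^ s) q (Suc b) = (1 - q ^ s) * q_poch (q * q ^ s) q b"
      by (rule q_poch_Suc_left)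
    have p2: "q_poch (q * q ^ s) q (Suc b) = q_poch (q * q ^ s) q b * (1 - q * q ^ s * q ^ b)"
      by (rule q_poch_Suc)
    have eqs: "(- (q ^ s)) ^ i = (-1) ^ i * (q ^ s) ^ i" "(- (q * q ^ s)) ^ i = (-1) ^ i * (q ^ i * (q ^ s) ^ i)"
      by (simp_all add: power_minus[of "q ^ s"] power_minus[of "q * q ^ s"] power_mult_distrib)
    show ?thesis
      unfolding G_def power_Suc[of q s] p1 p2 eqs
      by (simp add: P_def w_def poly_monom algebra_simps power_add power_mult_distrib)
  qed
  have beta: "(w has_sum ?B) UNIV"
    unfolding w_def by (rule has_sum_q_beta[OF q])
  have G: "\<bar>G i s\<bar> \<le> q ^ s" for i s
  proof -
    have "\<bar>G i s\<bar> = q ^ s * ((q ^ s) ^ (a + i) * q_poch (q ^ s) q (Suc b))"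
      using q q_poch_bounds[OF q, of "q ^ s" "Suc b"]
      by (simp add: G_def abs_mult power_abs power_add power_le_one)
    also have "\<dots> \<le> q ^ s * 1"
      using q by (intro mult_left_mono mult_le_one power_le_one q_poch_bounds[OF q] zero_le_power) auto
    finally show ?thesis by simp
  qed
  have "((\<lambda>y. det (mat (Suc n) (Suc n) (\<lambda>(p, j). w (y p) * poly (P j) (q ^ y p)))) has_sum
      det (mat (Suc n) (Suc n) (\<lambda>(p, j). H j (t p)))) ?A"
  proof (rule has_sum_det_interlacing_unbounded)
    show "t p \<le> t (Suc p)" if "p < n" for p
      by (rule t_mono[OF that])
    fix j s
    show "((\<lambda>s. w s * poly (P j) (q ^ s)) has_sum H j s) {s..}"
    proof (cases j)
      case 0
      have "w summable_on {s..}"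
        using has_sum_imp_summable[OF beta] by (rule summable_on_subset) auto
      then show ?thesis using 0 by (simp add: P_def H_def)
    next
      case (Suc i)
      then show ?thesis
        using has_sum_telescope_tail[OF q G] by (simp add: f H_def)
    qed
  qed
  then have "((\<lambda>y. (\<Prod>p<Suc n. w (y p)) * vandermonde (Suc n) (\<lambda>p. q ^ y p)) has_sum
     det (mat (Suc n) (Suc n) (\<lambda>(p, j). H j (t p))) / ?c) ?A"
  proof (rule has_sum_weighted_vandermonde)
    show "degree (P j) \<le> j" for j
      unfolding P_def by (cases j)
        (auto intro!: degree_add_le degree_monom_le intro: order.trans[OF degree_monom_le])
    have "(-1) ^ Suc j * coeff (P (Suc j)) (Suc j) = 1 - q ^ (a + b + 1 + 1 + j)" for j
      by (simp add: P_def algebra_simps flip: power_mult_distrib)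
    then show "(\<Prod>j<Suc n. (-1) ^ j * coeff (P j) j) = ?c"
      unfolding prod.lessThan_Suc_shift by (simp add: P_def)
    show "?c \<noteq> 0"
      by (intro less_imp_neq[symmetric] prod_pos one_minus_power_pos[OF q] ballI) auto
  qed
  from has_sum_cmult_right[OF this, of "page_const q (Suc n) a b"]
  have S: "((\<lambda>y. (\<Prod>p<Suc n. q ^ y p) * page_weight q (Suc n) a b y) has_sum
     page_const q (Suc n) a b * (det (mat (Suc n) (Suc n) (\<lambda>(p, j). H j (t p))) / ?c)) ?A"
    by (simp add: page_weight_def w_def prod.distrib mult_ac del: prod.lessThan_Suc)
  have D: "det (mat (Suc n) (Suc n) (\<lambda>(p, j). H j (t p))) =
      ?B * (q ^ (Suc a * n) * (\<Prod>p<n. (q ^ l p) ^ Suc a * q_poch (q * q ^ l p) q (Suc b)) *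
        (q ^ (n choose 2) * vandermonde n (\<lambda>p. q ^ l p)))"
  proof -
    let ?M = "mat (Suc n) (Suc n) (\<lambda>(p, j). H j (t p))"
    have "det ?M = (\<Sum>j<Suc n. ?M $$ (0, j) * cofactor ?M 0 j)"
      by (rule laplace_expansion_row) auto
    also have "\<dots> = ?M $$ (0, 0) * cofactor ?M 0 0"
      unfolding sum.lessThan_Suc_shift by (simp add: H_def G_def t_def q_poch_Suc_left)
    also have "?M $$ (0, 0) = ?B"
      using infsumI[OF beta] by (simp add: H_def t_def)
    also have "cofactor ?M 0 0 = det (mat n n (\<lambda>(p, i). (q * q ^ l p) ^ Suc a * q_poch (q * q ^ l p) q (Suc b)
        * poly (monom ((-1) ^ i) i) (q * q ^ l p)))"
      unfolding cofactor_def mat_delete_def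
      by (simp, intro arg_cong[of _ _ det] eq_matI)
         (auto simp: H_def G_def t_def poly_monom power_minus[of "q * q ^ _"])
    also have "\<dots> = (\<Prod>p<n. (q * q ^ l p) ^ Suc a * q_poch (q * q ^ l p) q (Suc b)) * vandermonde n (\<lambda>p. q * q ^ l p)"
      by (subst det_alternant[OF degree_monom_le]) (simp flip: power_mult_distrib)
    \<comment> \<open>Each of the \<open>n\<close> remaining rows sits at \<open>Suc (l p)\<close>
      and releases a factor \<open>q ^ Suc a\<close>.\<close>
    also have "(\<Prod>p<n. (q * q ^ l p) ^ Suc a * q_poch (q * q ^ l p) q (Suc b)) =
       q ^ (Suc a * n) * (\<Prod>p<n. (q ^ l p) ^ Suc a * q_poch (q * q ^ l p) q (Suc b))"
      unfolding power_mult_distrib[of q] by (simp only: mult.assoc prod.distrib[of "\<lambda>p. q ^ Suc a"] prod_constant card_lessThan power_mult)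
    finally show ?thesis by (simp only: vandermonde_scale)
  qed
  have K: "page_const q (Suc n) a b * ?B * q ^ (Suc a * n) * q ^ (n choose 2) / ?c =
      q ^ (Suc n choose 2) * page_const q n (Suc a) (Suc b)"
  proof -
    have sf: "q_poch_superfact q (n + Suc a + Suc b) =
       q_poch_superfact q (Suc n + a + b) * (q_poch q q (Suc (a + b)) * ?c)"
      using q_poch_q_add[of q "Suc (a + b)" n] q_poch_superfact_Suc[of q "Suc (n + a + b)"]
      by (simp add: algebra_simps)
    \<comment> \<open>Pascal's rule gives the recursion satisfied by the exponent of
      \<open>q\<close> in \<open>page_const\<close>.\<close>
    have e: "q ^ (Suc a * n) * q ^ (n choose 2) * q ^ (Suc a * (n choose 2) + (n choose 3)) =
        q ^ (Suc n choose 2) * q ^ (a * (Suc n choose 2) + (Suc n choose 3))"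
      unfolding power_add[symmetric] by (rule arg_cong[of _ _ "(^) q"])
        (simp add: numeral_3_eq_3 numeral_2_eq_2 algebra_simps)
    have "?c > 0"
      by (intro prod_pos one_minus_power_pos[OF q] ballI) auto
    moreover have "q ^ i > 0" for i
      using q by simp
    ultimately show ?thesis
      unfolding page_const_def sf q_poch_superfact_Suc
      using e q_poch_q_pos[OF q] q_poch_superfact_pos[OF q]
      by (simp add: divide_simps less_imp_neq[symmetric] del: prod.lessThan_Suc power_Suc binomial_Suc_Suc)
  qed
  have "page_const q (Suc n) a b * (det (mat (Suc n) (Suc n) (\<lambda>(p, j). H j (t p))) / ?c) = q ^ (Suc n choose 2) * page_weight q n (Suc a) (Suc b) l"
  proof -
    have "page_const q (Suc n) a b * (det (mat (Suc n) (Suc n) (\<lambda>(p, j). H j (t p))) / ?c) = (page_const q (Suc n) a b * ?B * q ^ (Suc a * n) * q ^ (n choose 2) / ?c) *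
      ((\<Prod>p<n. (q ^ l p) ^ Suc a * q_poch (q * q ^ l p) q (Suc b)) * vandermonde n (\<lambda>p. q ^ l p))"
      unfolding D by (simp add: mult_ac del: power_Suc)
    then show ?thesis
      unfolding K page_weight_def by (simp only: mult.assoc)
  qed
  with S show ?thesis
    by (simp only: t_def nat.case)
qed

lemma page_weight_cong:
  assumes "\<And>p. p < n \<Longrightarrow> l p = l' p"
  shows "page_weight q n a b l = page_weight q n a b l'"
  using assms unfolding page_weight_def vandermonde_def
  by (intro arg_cong2[of _ _ _ _ "(*)"] prod.cong refl) auto

text \<open>The entries of the next diagonal, shifted by their position, range independently over
  these intervals; the topmost one is unbounded if the page has a further row above.\<close>

definition knot_interval :: "nat \<Rightarrow> nat \<Rightarrow> (nat \<Rightarrow> nat) \<Rightarrow> nat \<Rightarrow> nat set" where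
  "knot_interval n b l p =
     (if b = 0 then {y. l p \<le> y \<and> (Suc p < n \<longrightarrow> y < l (Suc p))}
      else {y. (0 < p \<longrightarrow> l (p - 1) < y) \<and> (p < n \<longrightarrow> y \<le> l p)})"

text \<open>The next diagonal drops the bottom cell exactly when no further column remains
  (\<open>b = 0\<close>) and gains a top cell exactly when a row above remains
  (\<open>a > 0\<close>). Truncated subtraction keeps an exhausted side at 0.\<close>

lemma page_weight_step:
  assumes q: "0 < q" "q < 1" and l: "\<And>p. Suc p < n \<Longrightarrow> l p < l (Suc p)" and n: "n \<ge> 1"
    and n': "n' = (if b = 0 then n - 1 else n) + (if a = 0 then 0 else 1)"
  shows "((\<lambda>y. (\<Prod>p<n'. q ^ y p) * page_weight q n' (a - 1) (b - 1) y) has_sum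
      q ^ (n' choose 2) * page_weight q n a b l) (PiE {..<n'} (knot_interval n b l))"
proof -
  obtain k where k: "n = Suc k" using n by (cases n) auto
  show ?thesis
  proof (cases b)
    case b: 0
    show ?thesis
    proof (cases a)
      case 0
      have "PiE {..<n'} (knot_interval n b l) = PiE {..<k} (\<lambda>p. {l p..<l (Suc p)})"
        by (simp add: n' k b 0) (rule PiE_cong, auto simp: knot_interval_def)
      then show ?thesis
        using page_weight_step_shrink[OF q, of k l] l by (simp add: n' 0 b k)
    next
      case (Suc a')
      have "PiE {..<n'} (knot_interval n b l) =
          PiE {..<Suc k} (\<lambda>p. if p < k then {l p..<l (Suc p)} else {l p..})"
        by (simp add: n' k b Suc) (rule PiE_cong, auto simp: knot_interval_def)
      then show ?thesis
        using page_weight_step_row[OF q, of k l a'] l by (simp add: n' Suc b k del: prod.lessThan_Suc binomial_Suc_Suc)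
    qed
  next
    case b: (Suc b')
    show ?thesis
    proof (cases a)
      case 0
      have "PiE {..<n'} (knot_interval n b l) =
          PiE {..<n} (\<lambda>p. {(case p of 0 \<Rightarrow> 0 | Suc p' \<Rightarrow> Suc (l p'))..<Suc (l p)})"
        by (simp add: n' b 0) (rule PiE_cong, auto simp: knot_interval_def split: nat.split)
      then show ?thesis
        using page_weight_step_col[OF q, of n l b'] l by (simp add: n' 0 b)
    next
      case (Suc a')
      have "PiE {..<n'} (knot_interval n b l) =
          PiE {..<Suc n} (\<lambda>p. if p < n then {(case p of 0 \<Rightarrow> 0 | Suc p' \<Rightarrow> Suc (l p'))..<Suc (l p)}
            else {(case p of 0 \<Rightarrow> 0 | Suc p' \<Rightarrow> Suc (l p'))..})"
        by (simp add: n' b Suc) (rule PiE_cong, auto simp: knot_interval_def split: nat.split)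
      then show ?thesis
        using page_weight_step_grow[OF q, of n l a' b'] l
        by (simp add: n' Suc b del: prod.lessThan_Suc binomial_Suc_Suc)
    qed
  qed
qed


section \<open>Peeling a page by diagonals\<close>

lemma finite_staircase: "finite (staircase n a b)"
proof (rule finite_subset)
  show "staircase n a b \<subseteq> {- int a + 1..int n} \<times> {1..int n + int b}"
    by (auto simp: staircase_def)
qed auto

text \<open>Comparing neighbours only keeps the condition local: their contents differ by one, so it
  splits between consecutive diagonals.\<close>

definition decreasing_on :: "(int \<times> int) set \<Rightarrow> (int \<times> int \<Rightarrow> nat) \<Rightarrow> bool" where
  "decreasing_on X f \<longleftrightarrow>
     (\<forall>i j. (i, j) \<in> X \<and> (i, j + 1) \<in> X \<longrightarrow> f (i, j + 1) \<le> f (i, j)) \<and>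
     (\<forall>i j. (i, j) \<in> X \<and> (i + 1, j) \<in> X \<longrightarrow> f (i + 1, j) \<le> f (i, j))"

lemma decreasing_on_cong:
  assumes "\<And>c. c \<in> X \<Longrightarrow> f c = g c"
  shows "decreasing_on X f \<longleftrightarrow> decreasing_on X g"
  using assms unfolding decreasing_on_def by auto

locale page =
  fixes n a b :: nat and q :: real
  assumes n: "n \<ge> 1" and q: "0 < q" "q < 1"
begin

definition level :: "nat \<Rightarrow> (int \<times> int) set" where
  "level d = {(i, j) \<in> staircase n a b. j - i = int d}"

definition beyond :: "nat \<Rightarrow> (int \<times> int) set" where
  "beyond d = {(i, j) \<in> staircase n a b. j - i \<ge> int d}"

text \<open>\<open>d - b\<close> is truncated: the last row bounds the diagonals of content up to
  \<open>b\<close>, after which the last column pushes the bottom up by one row per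
  diagonal.\<close>

definition bottom :: "nat \<Rightarrow> int" where
  "bottom d = int n - int (d - b)"

definition width :: "nat \<Rightarrow> nat" where
  "width d = n + min d a - (d - b)"

text \<open>The cells of content \<open>d\<close>, enumerated from bottom to top.\<close>

definition cell :: "nat \<Rightarrow> nat \<Rightarrow> int \<times> int" where
  "cell d p = (bottom d - int p, bottom d - int p + int d)"

lemma finite_level: "finite (level d)" and finite_beyond: "finite (beyond d)"
  unfolding level_def beyond_def by (auto intro: finite_subset[OF _ finite_staircase])

lemma beyond_Suc: "beyond d = level d \<union> beyond (Suc d)" "level d \<inter> beyond (Suc d) = {}"
  by (auto simp: beyond_def level_def)

lemma level_memD: "(i, j) \<in> level d \<Longrightarrow> i \<le> bottom d" "(i, j) \<in> level d \<Longrightarrow> j = i + int d"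
  by (auto simp: level_def bottom_def staircase_def)

lemma cell_in_level: "cell d p \<in> level d \<longleftrightarrow> p < width d"
proof (cases "d \<le> b")
  case True
  then show ?thesis
    by (auto simp: level_def bottom_def staircase_def cell_def width_def min_def split: if_splits)
next
  case False
  then have "int (d - b) = int d - int b" by simp
  with False show ?thesis
    by (auto simp: level_def bottom_def staircase_def cell_def width_def min_def split: if_splits)
qed

lemma inj_cell: "inj (cell d)"
  by (auto simp: inj_def cell_def)

lemma level_eq: "level d = cell d ` {..<width d}"
proof (intro equalityI subsetI)
  fix c assume c: "c \<in> level d"
  obtain i j where ij: "c = (i, j)" by (cases c)
  define p where "p = nat (bottom d - i)"
  have "c = cell d p"
    using level_memD[of i j d] c by (auto simp: ij cell_def p_def)
  then show "c \<in> cell d ` {..<width d}"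
    using c cell_in_level by auto
next
  fix c assume "c \<in> cell d ` {..<width d}"
  then show "c \<in> level d" using cell_in_level by auto
qed

lemma ball_level: "(\<forall>c\<in>level d. Q c) \<longleftrightarrow> (\<forall>p<width d. Q (cell d p))"
  unfolding level_eq by auto

text \<open>The two diagonals are separate arguments so that one can be prescribed while the other
  is summed over.\<close>

definition interlaced :: "nat \<Rightarrow> (int \<times> int \<Rightarrow> nat) \<Rightarrow> (int \<times> int \<Rightarrow> nat) \<Rightarrow> bool" where
  "interlaced d g \<nu> \<longleftrightarrow> (\<forall>(i, j) \<in> level (Suc d).
     ((i, j - 1) \<in> level d \<longrightarrow> \<nu> (i, j) \<le> g (i, j - 1)) \<and>
     ((i + 1, j) \<in> level d \<longrightarrow> g (i + 1, j) \<le> \<nu> (i, j)))"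

lemma decreasing_on_beyond:
  "decreasing_on (beyond d) h \<longleftrightarrow> interlaced d h h \<and> decreasing_on (beyond (Suc d)) h"
proof
  assume "decreasing_on (beyond d) h"
  then show "interlaced d h h \<and> decreasing_on (beyond (Suc d)) h"
    unfolding decreasing_on_def interlaced_def
  proof (intro conjI ballI allI impI)
    fix c assume c: "c \<in> level (Suc d)"
    assume dec: "(\<forall>i j. (i, j) \<in> beyond d \<and> (i, j + 1) \<in> beyond d \<longrightarrow> h (i, j + 1) \<le> h (i, j)) \<and>
      (\<forall>i j. (i, j) \<in> beyond d \<and> (i + 1, j) \<in> beyond d \<longrightarrow> h (i + 1, j) \<le> h (i, j))"
    obtain i j where ij: "c = (i, j)" by (cases c)
    have "(i, j) \<in> beyond d"
      using c by (auto simp: ij level_def beyond_def)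
    moreover have "level d \<subseteq> beyond d" using beyond_Suc(1)[of d] by blast
    ultimately show "case c of (i, j) \<Rightarrow> ((i, j - 1) \<in> level d \<longrightarrow> h (i, j) \<le> h (i, j - 1)) \<and>
        ((i + 1, j) \<in> level d \<longrightarrow> h (i + 1, j) \<le> h (i, j))"
      using dec[THEN conjunct1, rule_format, of i "j - 1"] dec[THEN conjunct2, rule_format, of i j]
      by (auto simp: ij)
  qed (auto simp: beyond_Suc(1)[of d])
next
  assume H: "interlaced d h h \<and> decreasing_on (beyond (Suc d)) h"
  have row: "h (i, j + 1) \<le> h (i, j)" if "(i, j) \<in> beyond d" "(i, j + 1) \<in> beyond d" for i j
  proof (cases "(i, j) \<in> level d")
    case True
    then have "(i, j + 1) \<in> level (Suc d)"
      using that by (auto simp: level_def beyond_def)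
    then show ?thesis using H True by (force simp: interlaced_def)
  next
    case False
    then have "(i, j) \<in> beyond (Suc d)" "(i, j + 1) \<in> beyond (Suc d)"
      using that by (auto simp: level_def beyond_def)
    then show ?thesis using H by (auto simp: decreasing_on_def)
  qed
  have col: "h (i + 1, j) \<le> h (i, j)" if "(i, j) \<in> beyond d" "(i + 1, j) \<in> beyond d" for i j
  proof (cases "(i + 1, j) \<in> level d")
    case True
    then have "(i, j) \<in> level (Suc d)"
      using that by (auto simp: level_def beyond_def)
    then show ?thesis using H True by (force simp: interlaced_def)
  next
    case False
    then have "(i, j) \<in> beyond (Suc d)" "(i + 1, j) \<in> beyond (Suc d)"
      using that by (auto simp: level_def beyond_def)
    then show ?thesis using H by (auto simp: decreasing_on_def)
  qed
  show "decreasing_on (beyond d) h"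
    using row col by (auto simp: decreasing_on_def)
qed

text \<open>Adding the position to the entries of a diagonal, read from bottom to top, makes
  them strictly increasing.\<close>

definition strict_seq :: "nat \<Rightarrow> (int \<times> int \<Rightarrow> nat) \<Rightarrow> nat \<Rightarrow> nat" where
  "strict_seq d g p = g (cell d p) + p"

text \<open>Counted from the bottom, the neighbours of entry \<open>p\<close> are the old entries
  \<open>p - 1\<close> and \<open>p\<close> while a column remains, and \<open>p\<close> and
  \<open>Suc p\<close> once bottom cells are dropped. The shift makes exactly one of the two weak
  inequalities strict, so the intervals are disjoint.\<close>

lemma interlaced_iff:
  "interlaced d g \<nu> \<longleftrightarrow>
     (\<forall>p<width (Suc d). strict_seq (Suc d) \<nu> p \<in> knot_interval (width d) (b - d) (strict_seq d g) p)"
proof -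
  have "(case cell (Suc d) p of (i, j) \<Rightarrow>
      ((i, j - 1) \<in> level d \<longrightarrow> \<nu> (i, j) \<le> g (i, j - 1)) \<and>
      ((i + 1, j) \<in> level d \<longrightarrow> g (i + 1, j) \<le> \<nu> (i, j))) \<longleftrightarrow>
    strict_seq (Suc d) \<nu> p \<in> knot_interval (width d) (b - d) (strict_seq d g) p"
    if p: "p < width (Suc d)" for p
  proof (cases "d < b")
    case True
    obtain i j where ij: "cell (Suc d) p = (i, j)" by (cases "cell (Suc d) p")
    have left: "(i, j - 1) = cell d p"
      using ij True by (auto simp: cell_def bottom_def)
    have s: "strict_seq (Suc d) \<nu> p = \<nu> (i, j) + p"
      by (simp add: strict_seq_def ij)
    have A: "((i, j - 1) \<in> level d \<longrightarrow> \<nu> (i, j) \<le> g (i, j - 1)) \<longleftrightarrow>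
        (p < width d \<longrightarrow> strict_seq (Suc d) \<nu> p \<le> strict_seq d g p)"
      unfolding left cell_in_level s strict_seq_def[of d] by simp
    have B: "((i + 1, j) \<in> level d \<longrightarrow> g (i + 1, j) \<le> \<nu> (i, j)) \<longleftrightarrow>
        (0 < p \<longrightarrow> strict_seq d g (p - 1) < strict_seq (Suc d) \<nu> p)"
    proof (cases "p = 0")
      case True
      then have "(i + 1, j) \<notin> level d"
        using ij \<open>d < b\<close> level_memD(1)[of "i + 1" j d] by (auto simp: cell_def bottom_def)
      then show ?thesis using True by simp
    next
      case False
      then have below: "(i + 1, j) = cell d (p - 1)"
        using ij \<open>d < b\<close> by (auto simp: cell_def bottom_def)
      have "p - 1 < width d"
        using p False \<open>d < b\<close> by (auto simp: width_def min_def split: if_splits)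
      then show ?thesis
        unfolding below cell_in_level s strict_seq_def[of d] using False by auto
    qed
    show ?thesis
      unfolding ij prod.case A B using True by (auto simp: knot_interval_def)
  next
    case False
    obtain i j where ij: "cell (Suc d) p = (i, j)" by (cases "cell (Suc d) p")
    have "int (d - b) = int d - int b" "int (Suc d - b) = int d - int b + 1"
      using False by auto
    then have left: "(i, j - 1) = cell d (Suc p)" and below: "(i + 1, j) = cell d p"
      using ij by (auto simp: cell_def bottom_def)
    have w: "p < width d"
      using p False by (auto simp: width_def min_def split: if_splits)
    have s: "strict_seq (Suc d) \<nu> p = \<nu> (i, j) + p"
      by (simp add: strict_seq_def ij)
    have A: "((i, j - 1) \<in> level d \<longrightarrow> \<nu> (i, j) \<le> g (i, j - 1)) \<longleftrightarrow>
        (Suc p < width d \<longrightarrow> strict_seq (Suc d) \<nu> p < strict_seq d g (Suc p))"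
      unfolding left cell_in_level s strict_seq_def[of d] by auto
    have B: "((i + 1, j) \<in> level d \<longrightarrow> g (i + 1, j) \<le> \<nu> (i, j)) \<longleftrightarrow>
        strict_seq d g p \<le> strict_seq (Suc d) \<nu> p"
      unfolding below cell_in_level s strict_seq_def[of d] using w by auto
    show ?thesis
      unfolding ij prod.case A B using False by (auto simp: knot_interval_def)
  qed
  then show ?thesis
    unfolding interlaced_def ball_level by simp
qed

lemma width_Suc:
  assumes "width d \<ge> 1"
  shows "width (Suc d) = (if b - d = 0 then width d - 1 else width d) + (if a - d = 0 then 0 else 1)"
  using assms by (auto simp: width_def min_def)

lemma width_pos: "d < n + a + b \<Longrightarrow> width d \<ge> 1"
  using n by (auto simp: width_def min_def)

text \<open>Disjointness and order of the intervals make the new diagonal strictly increasing after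
  the shift, the hypothesis under which the next step applies.\<close>

lemma knot_interval_strict:
  assumes "p < width (Suc d)" "Suc p < width (Suc d)"
    and "y p \<in> knot_interval (width d) (b - d) l p"
    and "y (Suc p) \<in> knot_interval (width d) (b - d) l (Suc p)"
  shows "y p < y (Suc p)"
proof -
  have "p < width d" "b - d = 0 \<Longrightarrow> Suc p < width d"
    using assms(1,2) by (auto simp: width_def min_def split: if_splits)
  then show ?thesis
    using assms(3,4) by (auto simp: knot_interval_def split: if_splits)
qed

text \<open>Lets the shift by positions be undone in the natural numbers without truncation.\<close>

lemma knot_interval_ge:
  assumes "p < width (Suc d)" "y \<in> knot_interval (width d) (b - d) (strict_seq d g) p"
  shows "p \<le> y"
  using assms by (cases p) (auto simp: knot_interval_def strict_seq_def split: if_splits)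

text \<open>The prescribed diagonal \<open>g\<close> is a parameter and not part of
  \<open>f\<close>, so that the recursion can pass a diagonal just summed over on as the next
  prescription.\<close>

definition fillings :: "nat \<Rightarrow> (int \<times> int \<Rightarrow> nat) \<Rightarrow> (int \<times> int \<Rightarrow> nat) set" where
  "fillings d g = {f \<in> beyond (Suc d) \<rightarrow>\<^sub>E UNIV.
     decreasing_on (beyond d) (\<lambda>c. if c \<in> beyond (Suc d) then f c else g c)}"

lemma interlaced_cong:
  assumes "\<And>c. c \<in> level d \<Longrightarrow> g c = g' c" "\<And>c. c \<in> level (Suc d) \<Longrightarrow> \<nu> c = \<nu>' c"
  shows "interlaced d g \<nu> \<longleftrightarrow> interlaced d g' \<nu>'"
  using assms unfolding interlaced_def by (auto split: prod.splits)

lemma fillings_iff: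
  "f \<in> fillings d g \<longleftrightarrow> f \<in> beyond (Suc d) \<rightarrow>\<^sub>E UNIV \<and> interlaced d g f \<and> decreasing_on (beyond (Suc d)) f"
proof -
  let ?h = "\<lambda>c. if c \<in> beyond (Suc d) then f c else g c"
  have "interlaced d ?h ?h \<longleftrightarrow> interlaced d g f"
    by (rule interlaced_cong) (use beyond_Suc[of d] beyond_Suc[of "Suc d"] in auto)
  moreover have "decreasing_on (beyond (Suc d)) ?h \<longleftrightarrow> decreasing_on (beyond (Suc d)) f"
    by (rule decreasing_on_cong) auto
  ultimately show ?thesis
    unfolding fillings_def decreasing_on_beyond[of d] by auto
qed

text \<open>Cells of content at least \<open>d + 2\<close> have no neighbour on level
  \<open>d\<close>, so once level \<open>Suc d\<close> is fixed the rest no longer sees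
  \<open>g\<close>.\<close>

lemma has_sum_fillings_split:
  "((\<lambda>f. q ^ (\<Sum>c\<in>beyond (Suc d). f c)) has_sum S) (fillings d g) \<longleftrightarrow>
   ((\<lambda>(\<nu>, f). q ^ (\<Sum>c\<in>level (Suc d). \<nu> c) * q ^ (\<Sum>c\<in>beyond (Suc (Suc d)). f c)) has_sum S)
     (SIGMA \<nu>:{\<nu> \<in> level (Suc d) \<rightarrow>\<^sub>E UNIV. interlaced d g \<nu>}. fillings (Suc d) \<nu>)"
proof (rule has_sum_reindex_bij_witness[where
      j = "\<lambda>f. (restrict f (level (Suc d)), restrict f (beyond (Suc (Suc d))))" and
      i = "\<lambda>(\<nu>, f). \<lambda>c\<in>beyond (Suc d). if c \<in> beyond (Suc (Suc d)) then f c else \<nu> c"])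
  let ?L = "level (Suc d)" and ?U = "beyond (Suc (Suc d))"
  let ?j = "\<lambda>f. (restrict f ?L, restrict f ?U)"
  let ?i = "\<lambda>(\<nu>, f). \<lambda>c\<in>beyond (Suc d). if c \<in> ?U then f c else \<nu> c"
  have split: "beyond (Suc d) = ?L \<union> ?U" "?L \<inter> ?U = {}"
    by (rule beyond_Suc)+
  show "?i (?j f) = f" if "f \<in> fillings d g" for f
    using that split by (auto simp: fillings_def fun_eq_iff PiE_def extensional_def)
  show "?j f \<in> (SIGMA \<nu>:{\<nu> \<in> ?L \<rightarrow>\<^sub>E UNIV. interlaced d g \<nu>}. fillings (Suc d) \<nu>)"
    if "f \<in> fillings d g" for f
  proof -
    have "interlaced d g (restrict f ?L)"
      using that interlaced_cong[of d g g f "restrict f ?L"] by (auto simp: fillings_iff)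
    moreover have "interlaced (Suc d) (restrict f ?L) (restrict f ?U)"
      using that interlaced_cong[of "Suc d" f "restrict f ?L" f "restrict f ?U"] beyond_Suc[of "Suc (Suc d)"]
      by (auto simp: fillings_iff decreasing_on_beyond[of "Suc d"])
    moreover have "decreasing_on ?U (restrict f ?U)"
      using that decreasing_on_cong[of ?U f "restrict f ?U"]
      by (auto simp: fillings_iff decreasing_on_beyond[of "Suc d"])
    ultimately show ?thesis
      by (auto simp: fillings_iff)
  qed
  show "?j (?i x) = x" if "x \<in> (SIGMA \<nu>:{\<nu> \<in> ?L \<rightarrow>\<^sub>E UNIV. interlaced d g \<nu>}. fillings (Suc d) \<nu>)" for x
    using that split by (auto simp: fillings_iff fun_eq_iff PiE_def extensional_def split: prod.splits)
  show "?i x \<in> fillings d g" if "x \<in> (SIGMA \<nu>:{\<nu> \<in> ?L \<rightarrow>\<^sub>E UNIV. interlaced d g \<nu>}. fillings (Suc d) \<nu>)" for x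
  proof -
    obtain \<nu> f where x: "x = (\<nu>, f)" by (cases x)
    have \<nu>: "interlaced d g \<nu>" and f: "interlaced (Suc d) \<nu> f" "decreasing_on ?U f"
      using that by (auto simp: x fillings_iff)
    have on_L: "?i x c = \<nu> c" if "c \<in> ?L" for c
      using that split by (auto simp: x)
    have on_U: "?i x c = f c" if "c \<in> ?U" for c
      using that split by (auto simp: x)
    have "interlaced d g (?i x) \<longleftrightarrow> interlaced d g \<nu>"
      by (rule interlaced_cong) (simp_all add: on_L)
    moreover have "interlaced (Suc d) (?i x) (?i x) \<longleftrightarrow> interlaced (Suc d) \<nu> f"
      by (rule interlaced_cong) (use on_L on_U beyond_Suc[of "Suc (Suc d)"] in auto)
    moreover have "decreasing_on ?U (?i x) \<longleftrightarrow> decreasing_on ?U f"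
      by (rule decreasing_on_cong) (rule on_U)
    moreover note \<nu> f
    ultimately show ?thesis
      unfolding fillings_iff decreasing_on_beyond[of "Suc d"] by (auto simp: x)
  qed
  show "(case ?j f of (\<nu>, f) \<Rightarrow> q ^ (\<Sum>c\<in>?L. \<nu> c) * q ^ (\<Sum>c\<in>?U. f c)) = q ^ (\<Sum>c\<in>beyond (Suc d). f c)"
    if "f \<in> fillings d g" for f
    unfolding split(1) using sum.union_disjoint[OF finite_level finite_beyond split(2), of f]
    by (simp add: power_add)
qed simp

text \<open>Carries the summation over knot intervals over to the fillings of one diagonal. The
  positions add up to \<open>width (Suc d) choose 2\<close>, the very power of \<open>q\<close>
  produced by the step, so it cancels.\<close>

lemma has_sum_interlaced:
  assumes w: "width d \<ge> 1" and g: "\<And>p. Suc p < width d \<Longrightarrow> strict_seq d g p < strict_seq d g (Suc p)"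
  shows "((\<lambda>\<nu>. q ^ (\<Sum>c\<in>level (Suc d). \<nu> c) *
        page_weight q (width (Suc d)) (a - Suc d) (b - Suc d) (strict_seq (Suc d) \<nu>)) has_sum
      page_weight q (width d) (a - d) (b - d) (strict_seq d g))
    {\<nu> \<in> level (Suc d) \<rightarrow>\<^sub>E UNIV. interlaced d g \<nu>}"
proof -
  let ?w = "width (Suc d)" and ?l = "strict_seq d g"
  let ?K = "knot_interval (width d) (b - d) ?l"
  let ?j = "\<lambda>\<nu>. \<lambda>p\<in>{..<?w}. strict_seq (Suc d) \<nu> p"
  let ?i = "\<lambda>y. \<lambda>c\<in>level (Suc d). y (inv_into UNIV (cell (Suc d)) c) - inv_into UNIV (cell (Suc d)) c"
  have "((\<lambda>y. (\<Prod>p<?w. q ^ y p) * page_weight q ?w (a - d - 1) (b - d - 1) y) has_sum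
      q ^ (?w choose 2) * page_weight q (width d) (a - d) (b - d) ?l) (PiE {..<?w} ?K)"
    by (rule page_weight_step[OF q _ w width_Suc[OF w]]) (rule g)
  also have "?this \<longleftrightarrow> ((\<lambda>\<nu>. q ^ (?w choose 2) * (q ^ (\<Sum>c\<in>level (Suc d). \<nu> c) *
        page_weight q ?w (a - Suc d) (b - Suc d) (strict_seq (Suc d) \<nu>))) has_sum
      q ^ (?w choose 2) * page_weight q (width d) (a - d) (b - d) ?l)
      {\<nu> \<in> level (Suc d) \<rightarrow>\<^sub>E UNIV. interlaced d g \<nu>}"
  proof (rule has_sum_reindex_bij_witness[symmetric, where i = ?i and j = ?j])
    have inv_cell: "inv_into UNIV (cell (Suc d)) (cell (Suc d) p) = p" for p
      by (rule inv_f_f[OF inj_cell])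
    show "?i (?j \<nu>) = \<nu>" if "\<nu> \<in> {\<nu> \<in> level (Suc d) \<rightarrow>\<^sub>E UNIV. interlaced d g \<nu>}" for \<nu>
    proof (rule ext)
      fix c
      show "?i (?j \<nu>) c = \<nu> c"
      proof (cases "c \<in> level (Suc d)")
        case True
        then show ?thesis by (auto simp: level_eq inv_cell strict_seq_def)
      next
        case False
        then show ?thesis using that PiE_arb[of \<nu> "level (Suc d)" "\<lambda>_. UNIV" c] by simp
      qed
    qed
    show "?j \<nu> \<in> PiE {..<?w} ?K" if "\<nu> \<in> {\<nu> \<in> level (Suc d) \<rightarrow>\<^sub>E UNIV. interlaced d g \<nu>}" for \<nu>
      using that by (auto simp: interlaced_iff)
    have ge: "p \<le> y p" if "y \<in> PiE {..<?w} ?K" "p < ?w" for y p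
      using knot_interval_ge[of p d "y p" g] that by auto
    have seq: "strict_seq (Suc d) (?i y) p = y p" if "y \<in> PiE {..<?w} ?K" "p < ?w" for y p
      using ge[OF that] that(2) by (simp add: strict_seq_def inv_cell cell_in_level)
    show "?j (?i y) = y" if "y \<in> PiE {..<?w} ?K" for y
    proof (rule ext)
      fix p
      show "?j (?i y) p = y p"
        using seq[OF that] that by (cases "p < ?w") (auto simp: PiE_def extensional_def)
    qed
    show "?i y \<in> {\<nu> \<in> level (Suc d) \<rightarrow>\<^sub>E UNIV. interlaced d g \<nu>}" if "y \<in> PiE {..<?w} ?K" for y
      using seq[OF that] that by (auto simp: interlaced_iff)
    show "(\<Prod>p<?w. q ^ ?j \<nu> p) * page_weight q ?w (a - d - 1) (b - d - 1) (?j \<nu>) =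
      q ^ (?w choose 2) * (q ^ (\<Sum>c\<in>level (Suc d). \<nu> c) *
        page_weight q ?w (a - Suc d) (b - Suc d) (strict_seq (Suc d) \<nu>))" for \<nu>
    proof -
      have "(\<Sum>c\<in>level (Suc d). \<nu> c) = (\<Sum>p<?w. \<nu> (cell (Suc d) p))"
        unfolding level_eq by (subst sum.reindex) (auto intro: inj_on_subset[OF inj_cell])
      moreover have "(\<Sum>p<?w. p) = (?w choose 2)"
        by (simp add: choose_two atLeast0LessThan[symmetric] Sum_Ico_nat)
      ultimately have "(\<Prod>p<?w. q ^ ?j \<nu> p) = q ^ (?w choose 2) * q ^ (\<Sum>c\<in>level (Suc d). \<nu> c)"
        by (simp add: strict_seq_def power_sum[symmetric] power_add[symmetric] sum.distrib add.commute)
      moreover have "page_weight q ?w (a - d - 1) (b - d - 1) (?j \<nu>) =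
          page_weight q ?w (a - Suc d) (b - Suc d) (strict_seq (Suc d) \<nu>)"
        unfolding diff_diff_left by (simp, rule page_weight_cong) simp
      ultimately show ?thesis by simp
    qed
  qed simp
  finally show ?thesis
    using q by (subst (asm) has_sum_cmult_right_iff) auto
qed

theorem has_sum_fillings:
  assumes "\<And>p. Suc p < width d \<Longrightarrow> strict_seq d g p < strict_seq d g (Suc p)"
  shows "((\<lambda>f. q ^ (\<Sum>c\<in>beyond (Suc d). f c)) has_sum
    page_weight q (width d) (a - d) (b - d) (strict_seq d g)) (fillings d g)"
  using assms
proof (induction "n + a + b - d" arbitrary: d g)
  \<comment> \<open>No cell has content \<open>n + a + b\<close> or more: a single empty filling
    remains, and the weight of the empty page is 1.\<close>
  case 0
  then have w: "width d = 0" "width (Suc d) = 0" and ab: "a - d = 0" "b - d = 0"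
    by (auto simp: width_def min_def)
  have l: "level d = {}" "level (Suc d) = {}"
    using w by (simp_all add: level_eq)
  have "beyond (Suc d) = {}"
  proof -
    have "c \<notin> beyond (Suc d)" for c
      using 0 by (cases c) (auto simp: beyond_def staircase_def)
    then show ?thesis by auto
  qed
  then have "fillings d g = {\<lambda>_. undefined}"
    using l by (auto simp: fillings_iff interlaced_def decreasing_on_def PiE_def extensional_def)
  then show ?case
    using \<open>beyond (Suc d) = {}\<close>
    by (auto simp: w ab page_weight_def page_const_def vandermonde_def q_poch_superfact_def binomial_eq_0
        intro!: has_sum_finiteI)
next
  case (Suc k)
  then have w: "width d \<ge> 1" by (intro width_pos) auto
  let ?A = "{\<nu> \<in> level (Suc d) \<rightarrow>\<^sub>E UNIV. interlaced d g \<nu>}"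
  have IH: "((\<lambda>f. q ^ (\<Sum>c\<in>level (Suc d). \<nu> c) * q ^ (\<Sum>c\<in>beyond (Suc (Suc d)). f c)) has_sum
      q ^ (\<Sum>c\<in>level (Suc d). \<nu> c) *
      page_weight q (width (Suc d)) (a - Suc d) (b - Suc d) (strict_seq (Suc d) \<nu>)) (fillings (Suc d) \<nu>)"
    if "\<nu> \<in> ?A" for \<nu>
  proof (intro has_sum_cmult_right Suc.hyps(1))
    show "k = n + a + b - Suc d" using Suc.hyps(2) by simp
    show "strict_seq (Suc d) \<nu> p < strict_seq (Suc d) \<nu> (Suc p)" if "Suc p < width (Suc d)" for p
      using that \<open>\<nu> \<in> ?A\<close> by (intro knot_interval_strict[where l = "strict_seq d g"]) (auto simp: interlaced_iff)
  qed
  note outer = has_sum_interlaced[OF w Suc.prems]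
  show ?case
    unfolding has_sum_fillings_split
  proof (rule has_sum_SigmaI)
    \<comment> \<open>All terms are nonnegative, so convergence of the iterated sums already yields
      joint summability.\<close>
    show "(\<lambda>(\<nu>, f). q ^ (\<Sum>c\<in>level (Suc d). \<nu> c) * q ^ (\<Sum>c\<in>beyond (Suc (Suc d)). f c))
        summable_on Sigma ?A (fillings (Suc d))"
      using q by (intro summable_on_SigmaI[OF _ has_sum_imp_summable[OF outer]]) (auto intro: IH)
  qed (auto intro: IH outer)
qed

end


section \<open>Linear extensions and order-reversing maps\<close>

definition strict_total_on :: "'a set \<Rightarrow> ('a \<Rightarrow> 'a \<Rightarrow> bool) \<Rightarrow> bool" where
  "strict_total_on C lt \<longleftrightarrow>
     (\<forall>x\<in>C. \<not> lt x x) \<and>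
     (\<forall>x\<in>C. \<forall>y\<in>C. \<forall>z\<in>C. lt x y \<longrightarrow> lt y z \<longrightarrow> lt x z) \<and>
     (\<forall>x\<in>C. \<forall>y\<in>C. x \<noteq> y \<longrightarrow> lt x y \<or> lt y x)"

lemma
  assumes "strict_total_on C lt"
  shows strict_total_irrefl: "x \<in> C \<Longrightarrow> \<not> lt x x"
    and strict_total_trans: "x \<in> C \<Longrightarrow> y \<in> C \<Longrightarrow> z \<in> C \<Longrightarrow> lt x y \<Longrightarrow> lt y z \<Longrightarrow> lt x z"
    and strict_total_linear: "x \<in> C \<Longrightarrow> y \<in> C \<Longrightarrow> x \<noteq> y \<Longrightarrow> lt x y \<or> lt y x"
  using assms unfolding strict_total_on_def by metis+

definition rank_in :: "'a set \<Rightarrow> ('a \<Rightarrow> 'a \<Rightarrow> bool) \<Rightarrow> 'a \<Rightarrow> nat" where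
  "rank_in C lt c = card {x \<in> C. x = c \<or> lt x c}"

lemma rank_in_less:
  assumes "finite C" "strict_total_on C lt" "c \<in> C" "c' \<in> C" "lt c c'"
  shows "rank_in C lt c < rank_in C lt c'"
  unfolding rank_in_def
proof (rule psubset_card_mono)
  show "finite {x \<in> C. x = c' \<or> lt x c'}" using assms by simp
  show "{x \<in> C. x = c \<or> lt x c} \<subset> {x \<in> C. x = c' \<or> lt x c'}"
  proof (rule psubsetI)
    show "{x \<in> C. x = c \<or> lt x c} \<subseteq> {x \<in> C. x = c' \<or> lt x c'}"
      using assms strict_total_trans[OF assms(2), of _ c c'] by auto
    have "c' \<notin> {x \<in> C. x = c \<or> lt x c}"
      using assms strict_total_trans[OF assms(2), of c c' c] strict_total_irrefl[OF assms(2), of c] by auto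
    then show "{x \<in> C. x = c \<or> lt x c} \<noteq> {x \<in> C. x = c' \<or> lt x c'}"
      using assms by blast
  qed
qed

lemma rank_in_bij:
  assumes "finite C" "strict_total_on C lt"
  shows "bij_betw (rank_in C lt) C {1..card C}"
proof -
  have inj: "inj_on (rank_in C lt) C"
  proof (rule inj_onI, rule ccontr)
    fix x y assume xy: "x \<in> C" "y \<in> C" "rank_in C lt x = rank_in C lt y" "x \<noteq> y"
    then have "lt x y \<or> lt y x" using strict_total_linear[OF assms(2), of x y] by simp
    then show False
      using rank_in_less[OF assms, of x y] rank_in_less[OF assms, of y x] xy by auto
  qed
  have "rank_in C lt ` C \<subseteq> {1..card C}"
  proof (rule image_subsetI)
    fix c assume "c \<in> C"
    then have "{x \<in> C. x = c \<or> lt x c} \<noteq> {}" by auto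
    then have "rank_in C lt c > 0" using assms(1) by (auto simp: rank_in_def card_gt_0_iff)
    moreover have "rank_in C lt c \<le> card C"
      unfolding rank_in_def by (rule card_mono) (use assms in auto)
    ultimately show "rank_in C lt c \<in> {1..card C}" by simp
  qed
  then have "rank_in C lt ` C = {1..card C}"
    by (rule card_subset_eq[rotated]) (simp_all add: card_image[OF inj])
  with inj show ?thesis by (simp add: bij_betw_def)
qed

text \<open>\<open>B c\<close> counts the \<open>x\<close> with \<open>B x \<le> B c\<close>, so it
  is determined by the order. This recovers linear extensions and sorting permutations from the maps
  they sort.\<close>

lemma rank_in_unique:
  assumes C: "strict_total_on C lt" and B: "bij_betw B C {1..card C}"
    and mono: "\<And>x y. x \<in> C \<Longrightarrow> y \<in> C \<Longrightarrow> B x < B y \<Longrightarrow> lt x y" and c: "c \<in> C"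
  shows "B c = rank_in C lt c"
proof -
  have inj: "inj_on B C" and img: "B ` C = {1..card C}"
    using B by (auto simp: bij_betw_def)
  have "{x \<in> C. x = c \<or> lt x c} = {x \<in> C. B x \<le> B c}"
  proof (intro equalityI subsetI)
    fix x assume x: "x \<in> {x \<in> C. x = c \<or> lt x c}"
    show "x \<in> {x \<in> C. B x \<le> B c}"
    proof (rule ccontr)
      assume "x \<notin> {x \<in> C. B x \<le> B c}"
      then have "lt c x" "x \<noteq> c" using x c mono by (auto simp: not_le)
      then show False
        using x c strict_total_trans[OF C, of c x c] strict_total_irrefl[OF C, of c] by auto
    qed
  next
    fix x assume x: "x \<in> {x \<in> C. B x \<le> B c}"
    then show "x \<in> {x \<in> C. x = c \<or> lt x c}"
      using mono[of x c] c inj_onD[OF inj, of x c] by (auto simp: le_less)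
  qed
  moreover have "B ` {x \<in> C. B x \<le> B c} = {1..B c}"
  proof -
    have "B c \<le> card C" using img c by force
    have "B ` {x \<in> C. B x \<le> B c} = {y \<in> B ` C. y \<le> B c}" by auto
    also have "\<dots> = {1..B c}" unfolding img using \<open>B c \<le> card C\<close> by auto
    finally show ?thesis .
  qed
  moreover have "card (B ` {x \<in> C. B x \<le> B c}) = card {x \<in> C. B x \<le> B c}"
    by (rule card_image) (rule inj_on_subset[OF inj], auto)
  ultimately show ?thesis by (simp add: rank_in_def)
qed

lemma sum_tails:
  fixes g :: "nat \<Rightarrow> nat"
  shows "(\<Sum>i=1..N. \<Sum>k=i..N. g k) = (\<Sum>k=1..N. k * g k)"
proof (induction N)
  case (Suc N)
  have "(\<Sum>i=1..Suc N. \<Sum>k=i..Suc N. g k) = (\<Sum>i=1..N. \<Sum>k=i..Suc N. g k) + g (Suc N)"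
    by simp
  also have "(\<Sum>i=1..N. \<Sum>k=i..Suc N. g k) = (\<Sum>i=1..N. (\<Sum>k=i..N. g k) + g (Suc N))"
    by (intro sum.cong) auto
  finally show ?case using Suc.IH by (simp add: sum.distrib)
qed simp

text \<open>The slacks \<open>h i - h (Suc i) - \<delta> i\<close> are free natural numbers, and the
  one at \<open>i\<close> raises the first \<open>i\<close> entries, whence the factor
  \<open>1 / (1 - q ^ i)\<close>. The forced drops contribute \<open>i * \<delta> i\<close> in the
  same way, the origin of the major index.\<close>

lemma has_sum_decreasing_seqs:
  fixes \<delta> :: "nat \<Rightarrow> nat"
  assumes q: "0 < q" "q < (1::real)" and \<delta>: "\<delta> N = 0"
  shows "((\<lambda>h. q ^ (\<Sum>i=1..N. h i)) has_sum q ^ (\<Sum>i=1..N. i * \<delta> i) / (\<Prod>i=1..N. 1 - q ^ i))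
    {h \<in> {1..N} \<rightarrow>\<^sub>E UNIV. \<forall>i\<in>{1..<N}. h (Suc i) + \<delta> i \<le> h i}"
proof -
  let ?E = "{1..N} \<rightarrow>\<^sub>E (UNIV :: nat set)"
  let ?H = "{h \<in> ?E. \<forall>i\<in>{1..<N}. h (Suc i) + \<delta> i \<le> h i}"
  \<comment> \<open>Past its end the sequence counts as 0; with \<open>\<delta> N = 0\<close> the
    last slack is \<open>h N\<close> itself.\<close>
  let ?next = "\<lambda>h i. if i < N then h (Suc i) else 0"
  let ?j = "\<lambda>h. \<lambda>i\<in>{1..N}. h i - (?next h i + \<delta> i)"
  let ?i = "\<lambda>e. \<lambda>i\<in>{1..N}. \<Sum>k=i..N. e k + \<delta> k"
  have "((\<lambda>e. \<Prod>i\<in>{1..N}. (q ^ i) ^ e i) has_sum (\<Prod>i=1..N. 1 / (1 - q ^ i))) ?E"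
  proof (rule has_sum_prod_PiE)
    fix i assume "i \<in> {1..N}"
    then have "1 - q ^ i > 0" by (intro one_minus_power_pos[OF q]) auto
    then have "(\<lambda>t. (q ^ i) ^ t) sums (1 / (1 - q ^ i))"
      using q by (intro geometric_sums) auto
    then show "((\<lambda>t. (q ^ i) ^ t) has_sum 1 / (1 - q ^ i)) UNIV"
      using q by (intro sums_nonneg_imp_has_sum) auto
  qed simp
  then have "((\<lambda>e. q ^ (\<Sum>i=1..N. i * \<delta> i) * (\<Prod>i\<in>{1..N}. (q ^ i) ^ e i)) has_sum
      q ^ (\<Sum>i=1..N. i * \<delta> i) * (\<Prod>i=1..N. 1 / (1 - q ^ i))) ?E"
    by (rule has_sum_cmult_right)
  also have "?this \<longleftrightarrow> ((\<lambda>h. q ^ (\<Sum>i=1..N. h i)) has_sum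
      q ^ (\<Sum>i=1..N. i * \<delta> i) / (\<Prod>i=1..N. 1 - q ^ i)) ?H"
  proof (rule has_sum_reindex_bij_witness[where i = ?j and j = ?i])
    have step: "(\<Sum>k=i..N. e k + \<delta> k) = e i + \<delta> i + (if i < N then \<Sum>k=Suc i..N. e k + \<delta> k else 0)"
      if "i \<le> N" for e :: "nat \<Rightarrow> nat" and i
      using that sum.atLeast_Suc_atMost[of i N "\<lambda>k. e k + \<delta> k"] by auto
    show "?j (?i e) = e" if "e \<in> ?E" for e
    proof (rule ext)
      fix i
      show "?j (?i e) i = e i"
      proof (cases "i \<in> {1..N}")
        case True
        then show ?thesis using step[of i e] by (cases "i < N") simp_all
      next
        case False
        then show ?thesis by (simp only: restrict_apply if_False PiE_arb[OF that False])
      qed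
    qed
    show "?i e \<in> ?H" if "e \<in> ?E" for e
      using step by auto
    show "?i (?j h) = h" if "h \<in> ?H" for h
    proof (rule ext)
      fix i
      have eq: "(\<Sum>k=i..N. ?j h k + \<delta> k) = h i" if "1 \<le> i" "i \<le> N" for i
        using that(2,1)
      proof (induction i rule: inc_induct)
        case base
        then show ?case using \<delta> by simp
      next
        case (step i)
        have "(\<Sum>k=i..N. ?j h k + \<delta> k) = ?j h i + \<delta> i + h (Suc i)"
          using step sum.atLeast_Suc_atMost[of i N "\<lambda>k. ?j h k + \<delta> k"] by simp
        moreover have "h (Suc i) + \<delta> i \<le> h i"
          using \<open>h \<in> ?H\<close> step by auto
        ultimately show ?case using step by simp
      qed
      show "?i (?j h) i = h i"
      proof (cases "i \<in> {1..N}")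
        case True
        then show ?thesis using eq[of i] by simp
      next
        case False
        have "h \<in> ?E" using that by simp
        then have "h i = undefined" using False by (rule PiE_arb)
        with False show ?thesis by (simp only: restrict_apply if_False)
      qed
    qed
    show "?j h \<in> ?E" for h by auto
    show "q ^ (\<Sum>i=1..N. ?i e i) = q ^ (\<Sum>i=1..N. i * \<delta> i) * (\<Prod>i\<in>{1..N}. (q ^ i) ^ e i)" for e
    proof -
      have "(\<Sum>i=1..N. ?i e i) = (\<Sum>i=1..N. \<Sum>k=i..N. e k + \<delta> k)"
        by (intro sum.cong) auto
      also have "\<dots> = (\<Sum>i=1..N. i * \<delta> i) + (\<Sum>i=1..N. i * e i)"
        unfolding sum_tails by (simp add: distrib_left sum.distrib)
      finally show ?thesis
        by (simp add: power_add power_sum power_mult)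
    qed
    show "q ^ (\<Sum>i=1..N. i * \<delta> i) * (\<Prod>i=1..N. 1 / (1 - q ^ i)) =
        q ^ (\<Sum>i=1..N. i * \<delta> i) / (\<Prod>i=1..N. 1 - q ^ i)"
      by (simp add: prod_dividef)
  qed
  finally show ?thesis .
qed

section \<open>Stanley's decomposition of order-reversing maps\<close>

definition linear_extensions :: "'a set \<Rightarrow> ('a \<Rightarrow> 'a \<Rightarrow> bool) \<Rightarrow> ('a \<Rightarrow> nat) set" where
  "linear_extensions C prec = {B \<in> extensional C. bij_betw B C {1..card C} \<and>
     (\<forall>c\<in>C. \<forall>c'\<in>C. prec c c' \<longrightarrow> B c < B c')}"

definition order_reversing :: "'a set \<Rightarrow> ('a \<Rightarrow> 'a \<Rightarrow> bool) \<Rightarrow> ('a \<Rightarrow> nat) set" where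
  "order_reversing C prec = {f \<in> C \<rightarrow>\<^sub>E UNIV. \<forall>c\<in>C. \<forall>c'\<in>C. prec c c' \<longrightarrow> f c' \<le> f c}"

definition order_descents :: "'a set \<Rightarrow> ('a \<Rightarrow> 'a \<Rightarrow> bool) \<Rightarrow> ('a \<Rightarrow> nat) \<Rightarrow> nat set" where
  "order_descents C lt B =
     {i. 1 \<le> i \<and> i < card C \<and> \<not> lt (inv_into C B i) (inv_into C B (i + 1))}"

lemma finite_linear_extensions:
  assumes "finite C"
  shows "finite (linear_extensions C prec)"
proof (rule finite_subset)
  show "linear_extensions C prec \<subseteq> C \<rightarrow>\<^sub>E {1..card C}"
    by (auto simp: linear_extensions_def bij_betw_def PiE_def)
qed (use assms in \<open>auto intro: finite_PiE\<close>)

definition refined :: "('a \<Rightarrow> 'a \<Rightarrow> bool) \<Rightarrow> ('a \<Rightarrow> nat) \<Rightarrow> 'a \<Rightarrow> 'a \<Rightarrow> bool" where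
  "refined lt f c c' \<longleftrightarrow> f c' < f c \<or> f c = f c' \<and> lt c c'"

lemma strict_total_refined:
  assumes "strict_total_on C lt"
  shows "strict_total_on C (refined lt f)"
  unfolding strict_total_on_def refined_def
proof (intro conjI ballI impI)
  show "\<not> (f x < f x \<or> f x = f x \<and> lt x x)" if "x \<in> C" for x
    using strict_total_irrefl[OF assms that] by simp
  show "f z < f x \<or> f x = f z \<and> lt x z"
    if "x \<in> C" "y \<in> C" "z \<in> C" "f y < f x \<or> f x = f y \<and> lt x y" "f z < f y \<or> f y = f z \<and> lt y z" for x y z
    using strict_total_trans[OF assms that(1-3)] that(4,5) by auto
  show "(f y < f x \<or> f x = f y \<and> lt x y) \<or> (f x < f y \<or> f y = f x \<and> lt y x)"
    if "x \<in> C" "y \<in> C" "x \<noteq> y" for x y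
    using strict_total_linear[OF assms that] by auto
qed

text \<open>The block of maps belonging to \<open>B\<close>. Quantifying over all pairs makes
  disjointness a matter of ranks; the usual description by consecutive drops is derived from
  it.\<close>

definition sorted_by :: "'a set \<Rightarrow> ('a \<Rightarrow> 'a \<Rightarrow> bool) \<Rightarrow> ('a \<Rightarrow> nat) \<Rightarrow> ('a \<Rightarrow> nat) set" where
  "sorted_by C lt B = {f \<in> C \<rightarrow>\<^sub>E UNIV. \<forall>c\<in>C. \<forall>c'\<in>C. B c < B c' \<longrightarrow> refined lt f c c'}"

text \<open>Sorting by decreasing values, with ties broken by \<open>lt\<close>, assigns a linear extension to
  each order-reversing map; this is where naturality of the labelling \<open>lt\<close> enters.\<close>

lemma order_reversing_eq_Union:
  assumes C: "finite C" "strict_total_on C lt"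
    and natural: "\<And>c c'. c \<in> C \<Longrightarrow> c' \<in> C \<Longrightarrow> prec c c' \<Longrightarrow> lt c c'"
  shows "order_reversing C prec = (\<Union>B\<in>linear_extensions C prec. sorted_by C lt B)"
proof (intro equalityI subsetI)
  fix f assume f: "f \<in> order_reversing C prec"
  note st = strict_total_refined[OF C(2), of f]
  define B where "B = restrict (rank_in C (refined lt f)) C"
  have bij: "bij_betw B C {1..card C}"
    using rank_in_bij[OF C(1) st] by (simp add: B_def cong: bij_betw_cong)
  have less: "B c < B c'" if "c \<in> C" "c' \<in> C" "refined lt f c c'" for c c'
    using rank_in_less[OF C(1) st that] that by (simp add: B_def)
  have "B \<in> linear_extensions C prec"
    unfolding linear_extensions_def
  proof (intro CollectI conjI bij ballI impI)
    fix c c' assume c: "c \<in> C" "c' \<in> C" "prec c c'"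
    then have "f c' \<le> f c" "lt c c'" using f natural by (auto simp: order_reversing_def)
    then have "refined lt f c c'" by (auto simp: refined_def)
    then show "B c < B c'" using less c by simp
  qed (simp add: B_def)
  moreover have "f \<in> sorted_by C lt B"
    unfolding sorted_by_def
  proof (intro CollectI conjI ballI impI)
    fix c c' assume c: "c \<in> C" "c' \<in> C" "B c < B c'"
    then have "\<not> refined lt f c' c" using less[of c' c] by auto
    then show "refined lt f c c'"
      using strict_total_linear[OF st, of c c'] c by auto
  qed (use f in \<open>simp add: order_reversing_def\<close>)
  ultimately show "f \<in> (\<Union>B\<in>linear_extensions C prec. sorted_by C lt B)" by blast
next
  fix f assume "f \<in> (\<Union>B\<in>linear_extensions C prec. sorted_by C lt B)"
  then obtain B where B: "B \<in> linear_extensions C prec" "f \<in> sorted_by C lt B" by blast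
  then show "f \<in> order_reversing C prec"
    unfolding linear_extensions_def sorted_by_def order_reversing_def refined_def by fastforce
qed

text \<open>\<open>f\<close> determines \<open>B\<close>, which must be the rank in the order
  \<open>refined lt f\<close>.\<close>

lemma sorted_by_disjoint:
  assumes C: "strict_total_on C lt"
    and B: "B \<in> linear_extensions C prec" "B' \<in> linear_extensions C prec" "B \<noteq> B'"
  shows "sorted_by C lt B \<inter> sorted_by C lt B' = {}"
proof (rule ccontr)
  assume "sorted_by C lt B \<inter> sorted_by C lt B' \<noteq> {}"
  then obtain f where f: "f \<in> sorted_by C lt B" "f \<in> sorted_by C lt B'" by blast
  note st = strict_total_refined[OF C, of f]
  have "B c = rank_in C (refined lt f) c" "B' c = rank_in C (refined lt f) c" if "c \<in> C" for c
    using B f that by (auto intro!: rank_in_unique[OF st] simp: linear_extensions_def sorted_by_def)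
  then have "B = B'"
    using B by (intro extensionalityI[of _ C]) (auto simp: linear_extensions_def)
  then show False using B by simp
qed

text \<open>By transitivity consecutive positions suffice, and there ties are broken by
  \<open>lt\<close>, so equality is allowed exactly when the position is not a descent.\<close>

lemma sorted_by_iff:
  assumes C: "strict_total_on C lt" and B: "bij_betw B C {1..card C}"
  shows "f \<in> sorted_by C lt B \<longleftrightarrow> f \<in> C \<rightarrow>\<^sub>E UNIV \<and>
    (\<forall>i\<in>{1..<card C}. f (inv_into C B (Suc i)) + of_bool (i \<in> order_descents C lt B) \<le> f (inv_into C B i))"
proof -
  let ?c = "inv_into C B"
  have img: "B ` C = {1..card C}" and inj: "inj_on B C"
    using B by (auto simp: bij_betw_def)
  have cC: "?c i \<in> C" and Bc: "B (?c i) = i" if "i \<in> {1..card C}" for i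
    using that img by (auto intro: inv_into_into f_inv_into_f)
  have cB: "?c (B x) = x" if "x \<in> C" for x
    using inj that by simp
  have step: "refined lt f (?c i) (?c (Suc i)) \<longleftrightarrow>
      f (?c (Suc i)) + of_bool (i \<in> order_descents C lt B) \<le> f (?c i)" if "i \<in> {1..<card C}" for i
    using that by (auto simp: refined_def order_descents_def)
  note st = strict_total_refined[OF C, of f]
  have "(\<forall>c\<in>C. \<forall>c'\<in>C. B c < B c' \<longrightarrow> refined lt f c c') \<longleftrightarrow>
      (\<forall>i\<in>{1..<card C}. refined lt f (?c i) (?c (Suc i)))"
  proof (intro iffI ballI impI)
    fix i assume "\<forall>c\<in>C. \<forall>c'\<in>C. B c < B c' \<longrightarrow> refined lt f c c'" "i \<in> {1..<card C}"
    then show "refined lt f (?c i) (?c (Suc i))"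
      using cC[of i] cC[of "Suc i"] Bc[of i] Bc[of "Suc i"] by auto
  next
    fix c c' assume consec: "\<forall>i\<in>{1..<card C}. refined lt f (?c i) (?c (Suc i))"
      and c: "c \<in> C" "c' \<in> C" "B c < B c'"
    have "refined lt f (?c i) (?c k)" if "i < k" "1 \<le> i" "k \<le> card C" for i k
      using that
    proof (induction k rule: less_Suc_induct[consumes 1, case_names base trans])
      case (base i)
      then show ?case using consec by auto
    next
      case (trans i j k)
      then show ?case
        using strict_total_trans[OF st cC[of i] cC[of j] cC[of k]] by simp
    qed
    from this[OF c(3)] show "refined lt f c c'"
      using c img cB by (metis atLeastAtMost_iff imageI)
  qed
  also have "\<dots> \<longleftrightarrow> (\<forall>i\<in>{1..<card C}.
      f (?c (Suc i)) + of_bool (i \<in> order_descents C lt B) \<le> f (?c i))"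
    using step by blast
  finally show ?thesis by (auto simp: sorted_by_def)
qed

text \<open>Reading \<open>f\<close> along \<open>B\<close> gives a decreasing sequence whose forced
  drops are the indicator of the descents.\<close>

lemma has_sum_sorted_by:
  assumes C: "finite C" "strict_total_on C lt" and B: "bij_betw B C {1..card C}"
    and q: "0 < q" "q < (1::real)"
  shows "((\<lambda>f. q ^ (\<Sum>c\<in>C. f c)) has_sum
    q ^ \<Sum>(order_descents C lt B) / (\<Prod>i=1..card C. 1 - q ^ i)) (sorted_by C lt B)"
proof -
  let ?N = "card C" and ?c = "inv_into C B"
  let ?\<delta> = "\<lambda>i. of_bool (i \<in> order_descents C lt B) :: nat"
  let ?H = "{h \<in> {1..?N} \<rightarrow>\<^sub>E UNIV. \<forall>i\<in>{1..<?N}. h (Suc i) + ?\<delta> i \<le> h i}"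
  have img: "B ` C = {1..?N}" and inj: "inj_on B C"
    using B by (auto simp: bij_betw_def)
  have cC: "?c i \<in> C" and Bc: "B (?c i) = i" if "i \<in> {1..?N}" for i
    using that img by (auto intro: inv_into_into f_inv_into_f)
  have cB: "?c (B x) = x" if "x \<in> C" for x
    using inj that by simp
  have BC: "B x \<in> {1..?N}" if "x \<in> C" for x
    using that img by blast
  have "((\<lambda>h. q ^ (\<Sum>i=1..?N. h i)) has_sum q ^ (\<Sum>i=1..?N. i * ?\<delta> i) / (\<Prod>i=1..?N. 1 - q ^ i)) ?H"
    by (rule has_sum_decreasing_seqs[OF q]) (simp add: order_descents_def)
  also have "(\<Sum>i=1..?N. i * ?\<delta> i) = \<Sum>(order_descents C lt B)"
  proof -
    have "\<Sum>(order_descents C lt B) = (\<Sum>i\<in>{1..?N} \<inter> order_descents C lt B. i)"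
      by (rule sum.cong) (auto simp: order_descents_def)
    then show ?thesis by (simp add: sum.inter_restrict of_bool_def if_distrib cong: if_cong)
  qed
  also have "((\<lambda>h. q ^ (\<Sum>i=1..?N. h i)) has_sum
      q ^ \<Sum>(order_descents C lt B) / (\<Prod>i=1..?N. 1 - q ^ i)) ?H \<longleftrightarrow> ?thesis"
  proof (rule has_sum_reindex_bij_witness[where i = "\<lambda>f. \<lambda>i\<in>{1..?N}. f (?c i)" and j = "\<lambda>h. \<lambda>c\<in>C. h (B c)"])
    show "(\<lambda>i\<in>{1..?N}. (\<lambda>c\<in>C. h (B c)) (?c i)) = h" if "h \<in> ?H" for h
    proof (rule extensionalityI[of _ "{1..?N}"])
      show "h \<in> extensional {1..?N}" using that by (auto simp: PiE_def)
    qed (use cC Bc in auto)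
    show "(\<lambda>c\<in>C. h (B c)) \<in> sorted_by C lt B" if "h \<in> ?H" for h
      unfolding sorted_by_iff[OF C(2) B] using that cC Bc by auto
    show "(\<lambda>c\<in>C. (\<lambda>i\<in>{1..?N}. f (?c i)) (B c)) = f" if "f \<in> sorted_by C lt B" for f
    proof (rule extensionalityI[of _ C])
      show "f \<in> extensional C" using that by (auto simp: sorted_by_def PiE_def)
    qed (use cB BC in auto)
    show "(\<lambda>i\<in>{1..?N}. f (?c i)) \<in> ?H" if "f \<in> sorted_by C lt B" for f
      using that unfolding sorted_by_iff[OF C(2) B] by auto
    show "q ^ (\<Sum>c\<in>C. (\<lambda>c\<in>C. h (B c)) c) = q ^ (\<Sum>i=1..?N. h i)" for h
      using sum.reindex_bij_betw[OF B, of h] by simp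
  qed simp
  finally show ?thesis .
qed

theorem has_sum_order_reversing:
  assumes C: "finite C" "strict_total_on C lt" and q: "0 < q" "q < (1::real)"
    and natural: "\<And>c c'. c \<in> C \<Longrightarrow> c' \<in> C \<Longrightarrow> prec c c' \<Longrightarrow> lt c c'"
  shows "((\<lambda>f. q ^ (\<Sum>c\<in>C. f c)) has_sum
    (\<Sum>B\<in>linear_extensions C prec. q ^ \<Sum>(order_descents C lt B)) / (\<Prod>i=1..card C. 1 - q ^ i))
    (order_reversing C prec)"
proof -
  have "((\<lambda>f. q ^ (\<Sum>c\<in>C. f c)) has_sum
      (\<Sum>B\<in>linear_extensions C prec. q ^ \<Sum>(order_descents C lt B) / (\<Prod>i=1..card C. 1 - q ^ i)))
      (\<Union>B\<in>linear_extensions C prec. sorted_by C lt B)"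
  proof (rule sum_has_sum)
    show "finite (linear_extensions C prec)"
      by (rule finite_linear_extensions[OF C(1)])
    show "((\<lambda>f. q ^ (\<Sum>c\<in>C. f c)) has_sum
        q ^ \<Sum>(order_descents C lt B) / (\<Prod>i=1..card C. 1 - q ^ i)) (sorted_by C lt B)"
      if "B \<in> linear_extensions C prec" for B
      by (rule has_sum_sorted_by[OF C _ q]) (use that in \<open>simp add: linear_extensions_def\<close>)
  qed (rule sorted_by_disjoint[OF C(2)])
  then show ?thesis
    by (simp add: order_reversing_eq_Union[OF C natural] sum_divide_distrib)
qed

text \<open>Each injective \<open>k\<close> is made decreasing by exactly one permutation, so up to
  points where \<open>F\<close> vanishes the product set splits into \<open>fact n\<close>
  translates of one chamber.\<close>

lemma has_sum_symmetrize:
  fixes F :: "(nat \<Rightarrow> nat) \<Rightarrow> real"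
  assumes sym: "\<And>k \<pi>. \<pi> permutes {1..n} \<Longrightarrow> F (k \<circ> \<pi>) = F k"
    and zero: "\<And>k. \<not> inj_on k {1..n} \<Longrightarrow> F k = 0"
    and sum: "(F has_sum S) {k \<in> {1..n} \<rightarrow>\<^sub>E UNIV. \<forall>i\<in>{1..n}. \<forall>j\<in>{1..n}. i < j \<longrightarrow> k j < k i}"
  shows "(F has_sum fact n * S) ({1..n} \<rightarrow>\<^sub>E UNIV)"
proof -
  let ?I = "{1..n}"
  let ?dec = "\<lambda>k::nat \<Rightarrow> nat. \<forall>i\<in>?I. \<forall>j\<in>?I. i < j \<longrightarrow> k j < k i"
  let ?D = "\<lambda>\<pi>. {k \<in> ?I \<rightarrow>\<^sub>E (UNIV :: nat set). ?dec (k \<circ> \<pi>)}"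
  have "(F has_sum S) (?D \<pi>)" if \<pi>: "\<pi> permutes ?I" for \<pi>
  proof -
    have ext: "k \<circ> \<sigma> \<in> ?I \<rightarrow>\<^sub>E UNIV" if "k \<in> ?I \<rightarrow>\<^sub>E UNIV" "\<sigma> permutes ?I" for k :: "nat \<Rightarrow> nat" and \<sigma>
      using that permutes_not_in[OF that(2)] by (auto simp: PiE_def extensional_def)
    have "(F has_sum S) (?D \<pi>) \<longleftrightarrow> (F has_sum S) {k \<in> ?I \<rightarrow>\<^sub>E UNIV. ?dec k}"
    proof (rule has_sum_reindex_bij_witness[where i = "\<lambda>k. k \<circ> inv_into UNIV \<pi>" and j = "\<lambda>k. k \<circ> \<pi>"])
      have 1: "\<pi> \<circ> inv_into UNIV \<pi> = id" "inv_into UNIV \<pi> \<circ> \<pi> = id"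
        using permutes_inv_o[OF \<pi>] by auto
      show "k \<circ> \<pi> \<circ> inv_into UNIV \<pi> = k" "k \<circ> inv_into UNIV \<pi> \<circ> \<pi> = k" for k :: "nat \<Rightarrow> nat"
        by (simp_all add: o_assoc[symmetric] 1)
      then show "k \<circ> inv_into UNIV \<pi> \<in> ?D \<pi>" if "k \<in> {k \<in> ?I \<rightarrow>\<^sub>E UNIV. ?dec k}" for k
        using that ext[OF _ permutes_inv[OF \<pi>], of k] by (simp only: mem_Collect_eq) auto
      show "k \<circ> \<pi> \<in> {k \<in> ?I \<rightarrow>\<^sub>E UNIV. ?dec k}" if "k \<in> ?D \<pi>" for k
        using that ext[OF _ \<pi>, of k] by simp
      show "F (k \<circ> \<pi>) = F k" for k by (rule sym[OF \<pi>])
    qed simp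
    then show ?thesis using sum by simp
  qed
  moreover have "?D \<pi> \<inter> ?D \<pi>' = {}" if \<pi>: "\<pi> permutes ?I" "\<pi>' permutes ?I" "\<pi> \<noteq> \<pi>'" for \<pi> \<pi>'
  proof (rule ccontr)
    assume "?D \<pi> \<inter> ?D \<pi>' \<noteq> {}"
    then obtain k where k: "k \<in> ?D \<pi>" "k \<in> ?D \<pi>'" by blast
    \<comment> \<open>The order induced by \<open>k\<close> fixes the sorting permutation: the
      inverse of any permutation that sorts \<open>k\<close> is the rank function.\<close>
    define lt where "lt i j \<longleftrightarrow> k j < k i" for i j
    have rank: "inv_into UNIV \<sigma> c = rank_in ?I lt c \<and> strict_total_on ?I lt" if \<sigma>: "\<sigma> permutes ?I" "k \<in> ?D \<sigma>" "c \<in> ?I" for \<sigma> c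
    proof -
      have inv: "inv_into UNIV \<sigma> permutes ?I" using \<sigma> permutes_inv by blast
      have \<sigma>i: "\<sigma> (inv_into UNIV \<sigma> x) = x" for x
        using permutes_inverses(1)[OF \<sigma>(1)] by simp
      have lt: "lt x y" if "x \<in> ?I" "y \<in> ?I" "inv_into UNIV \<sigma> x < inv_into UNIV \<sigma> y" for x y
      proof -
        have "(k \<circ> \<sigma>) (inv_into UNIV \<sigma> y) < (k \<circ> \<sigma>) (inv_into UNIV \<sigma> x)"
          using \<sigma>(2) that permutes_in_image[OF inv] by blast
        then show ?thesis by (simp add: lt_def \<sigma>i)
      qed
      have "lt x y \<or> lt y x" if "x \<in> ?I" "y \<in> ?I" "x \<noteq> y" for x y
        using lt[OF that(1,2)] lt[OF that(2,1)] \<sigma>i that by (metis linorder_neqE_nat)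
      then have st: "strict_total_on ?I lt"
        unfolding strict_total_on_def by (auto simp: lt_def)
      moreover have "bij_betw (inv_into UNIV \<sigma>) ?I {1..card ?I}"
        using permutes_imp_bij[OF inv] by simp
      ultimately show ?thesis using rank_in_unique[OF st _ lt] \<sigma> by blast
    qed
    have "inv_into UNIV \<pi> c = inv_into UNIV \<pi>' c" for c
      using rank[OF \<pi>(1) k(1)] rank[OF \<pi>(2) k(2)] permutes_not_in[OF permutes_inv[OF \<pi>(1)]]
        permutes_not_in[OF permutes_inv[OF \<pi>(2)]] by (cases "c \<in> ?I") auto
    then have "inv_into UNIV \<pi> = inv_into UNIV \<pi>'" by auto
    then show False using \<pi> permutes_inv_inv by metis
  qed
  ultimately have U: "(F has_sum (\<Sum>\<pi>\<in>{\<pi>. \<pi> permutes ?I}. S)) (\<Union>\<pi>\<in>{\<pi>. \<pi> permutes ?I}. ?D \<pi>)"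
    by (intro sum_has_sum) (auto simp: finite_permutations)
  have card: "(\<Sum>\<pi>\<in>{\<pi>. \<pi> permutes ?I}. S) = fact n * S"
    using card_permutations[of ?I n] by simp
  have "(F has_sum fact n * S) (\<Union>\<pi>\<in>{\<pi>. \<pi> permutes ?I}. ?D \<pi>) \<longleftrightarrow> ?thesis"
  proof (rule has_sum_cong_neutral)
    fix k assume k: "k \<in> (?I \<rightarrow>\<^sub>E UNIV) - (\<Union>\<pi>\<in>{\<pi>. \<pi> permutes ?I}. ?D \<pi>)"
    show "F k = 0"
    proof (rule zero, rule notI)
      assume inj: "inj_on k ?I"
      define lt where "lt i j \<longleftrightarrow> k j < k i" for i j
      have st: "strict_total_on ?I lt"
        unfolding strict_total_on_def lt_def
      proof (intro conjI ballI impI)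
        fix i j assume "i \<in> ?I" "j \<in> ?I" "i \<noteq> j"
        then have "k i \<noteq> k j" using inj_onD[OF inj] by blast
        then show "k j < k i \<or> k i < k j" by linarith
      qed auto
      define B where "B = rank_in ?I lt"
      have B: "bij_betw B ?I ?I"
        using rank_in_bij[OF _ st] by (simp add: B_def)
      \<comment> \<open>Ranks, extended by the identity; the inverse lists the indices by decreasing
        \<open>k\<close>.\<close>
      define \<sigma> where "\<sigma> i = (if i \<in> ?I then B i else i)" for i
      have \<sigma>: "\<sigma> permutes ?I"
      proof (rule bij_imp_permutes)
        show "bij_betw \<sigma> ?I ?I"
          using B bij_betw_cong[of ?I \<sigma> B ?I] by (simp add: \<sigma>_def)
      qed (auto simp: \<sigma>_def)
      have inv: "inv_into UNIV \<sigma> permutes ?I" using \<sigma> permutes_inv by blast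
      have "?dec (k \<circ> inv_into UNIV \<sigma>)"
      proof (intro ballI impI)
        fix i j assume ij: "i \<in> ?I" "j \<in> ?I" "i < j"
        let ?i = "inv_into UNIV \<sigma> i" and ?j = "inv_into UNIV \<sigma> j"
        have I: "?i \<in> ?I" "?j \<in> ?I" using ij permutes_in_image[OF inv] by auto
        have "\<sigma> ?i = i" "\<sigma> ?j = j" using permutes_inverses(1)[OF \<sigma>] by auto
        then have "B ?i < B ?j" using I ij by (auto simp: \<sigma>_def)
        then have "\<not> lt ?j ?i" "?i \<noteq> ?j" using rank_in_less[OF _ st I(2,1)] by (auto simp: B_def)
        then have "lt ?i ?j" using strict_total_linear[OF st I] by simp
        then show "(k \<circ> inv_into UNIV \<sigma>) j < (k \<circ> inv_into UNIV \<sigma>) i" by (simp add: lt_def)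
      qed
      then show False using k inv by blast
    qed
  qed auto
  with U show ?thesis by (simp only: card)
qed


section \<open>Books\<close>

text \<open>Rows and columns of a staircase are contiguous, so distant cells are linked by chains of
  neighbours. Books compare arbitrary cells of a row or column, the peeling only neighbours.\<close>

lemma decreasing_on_staircase_iff:
  "decreasing_on (staircase n a b) h \<longleftrightarrow>
    (\<forall>i j j'. (i, j) \<in> staircase n a b \<and> (i, j') \<in> staircase n a b \<and> j < j' \<longrightarrow> h (i, j') \<le> h (i, j)) \<and>
    (\<forall>i i' j. (i, j) \<in> staircase n a b \<and> (i', j) \<in> staircase n a b \<and> i < i' \<longrightarrow> h (i', j) \<le> h (i, j))"
  (is "_ \<longleftrightarrow> ?rows \<and> ?cols")
proof
  assume dec: "decreasing_on (staircase n a b) h"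
  have row: "h (i, j + int t) \<le> h (i, j)"
    if "(i, j) \<in> staircase n a b" "(i, j + int t) \<in> staircase n a b" for i j t
    using that(2)
  proof (induction t)
    case (Suc t)
    have eq: "j + int (Suc t) = (j + int t) + 1" by simp
    have S: "(i, j + int t) \<in> staircase n a b"
      using that(1) Suc.prems by (auto simp: staircase_def)
    then have "h (i, (j + int t) + 1) \<le> h (i, j + int t)"
      using dec Suc.prems unfolding decreasing_on_def eq by blast
    also have "\<dots> \<le> h (i, j)" by (rule Suc.IH[OF S])
    finally show ?case unfolding eq .
  qed simp
  have col: "h (i + int t, j) \<le> h (i, j)"
    if "(i, j) \<in> staircase n a b" "(i + int t, j) \<in> staircase n a b" for i j t
    using that(2)
  proof (induction t)
    case (Suc t)
    have eq: "i + int (Suc t) = (i + int t) + 1" by simp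
    have S: "(i + int t, j) \<in> staircase n a b"
      using that(1) Suc.prems by (auto simp: staircase_def)
    then have "h ((i + int t) + 1, j) \<le> h (i + int t, j)"
      using dec Suc.prems unfolding decreasing_on_def eq by blast
    also have "\<dots> \<le> h (i, j)" by (rule Suc.IH[OF S])
    finally show ?case unfolding eq .
  qed simp
  show "?rows \<and> ?cols"
  proof (intro conjI allI impI)
    show "h (i, j') \<le> h (i, j)"
      if "(i, j) \<in> staircase n a b \<and> (i, j') \<in> staircase n a b \<and> j < j'" for i j j'
      using row[of i j "nat (j' - j)"] that by simp
    show "h (i', j) \<le> h (i, j)"
      if "(i, j) \<in> staircase n a b \<and> (i', j) \<in> staircase n a b \<and> i < i'" for i i' j
      using col[of i j "nat (i' - i)"] that by simp
  qed
qed (auto simp: decreasing_on_def)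

definition off_diag :: "nat \<Rightarrow> nat \<Rightarrow> nat \<Rightarrow> (int \<times> int) set" where
  "off_diag n a b = {(i, j) \<in> staircase n a b. i < j}"

lemma finite_off_diag: "finite (off_diag n a b)"
  unfolding off_diag_def by (auto intro: finite_subset[OF _ finite_staircase])

text \<open>The count is also the exponent of \<open>1 - q\<close> that separates a page constant
  from a quotient of \<open>q\<close>-superfactorials, which is why these powers later add up to
  \<open>N\<close>.\<close>

lemma card_off_diag: "card (off_diag n a b) = (n choose 2) + n * a + n * b + a * b"
proof -
  let ?U = "{- int a + 1..0} \<times> {1..int n + int b}"
  let ?L = "SIGMA i:{1..int n}. {i + 1..int n + int b}"
  have "off_diag n a b = ?U \<union> ?L" "?U \<inter> ?L = {}"
    by (auto simp: off_diag_def staircase_def)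
  then have "card (off_diag n a b) = card ?U + card ?L"
    by (simp add: card_Un_disjoint)
  also have "card ?U = a * (n + b)"
    by (simp add: card_cartesian_product nat_add_distrib)
  also have "card ?L = (\<Sum>i\<in>{1..int n}. nat (int n + int b - i))"
    by (subst card_SigmaI) (auto simp: algebra_simps)
  also have "\<dots> = (\<Sum>t<n. b + t)"
    by (rule sum.reindex_bij_witness[of _ "\<lambda>t. int n - int t" "\<lambda>i. nat (int n - i)"]) auto
  also have "\<dots> = n * b + (n choose 2)"
    by (simp add: sum.distrib choose_two atLeast0LessThan[symmetric] Sum_Ico_nat)
  finally show ?thesis by (simp add: algebra_simps)
qed

text \<open>The diagonal of a book is encoded by the strictly decreasing sequence
  \<open>k i = \<lambda> i + (n - i)\<close>, the exponents in \<open>x i = q ^ k i\<close>.\<close>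

definition diag_entry :: "nat \<Rightarrow> (nat \<Rightarrow> nat) \<Rightarrow> int \<Rightarrow> nat" where
  "diag_entry n k i = k (nat i) - (n - nat i)"

definition strict_decreasing :: "nat \<Rightarrow> (nat \<Rightarrow> nat) set" where
  "strict_decreasing n = {k \<in> {1..n} \<rightarrow>\<^sub>E UNIV. \<forall>i\<in>{1..n}. \<forall>j\<in>{1..n}. i < j \<longrightarrow> k j < k i}"

text \<open>Makes the truncated subtraction in \<open>diag_entry\<close> exact.\<close>

lemma strict_decreasing_ge:
  assumes "k \<in> strict_decreasing n" "1 \<le> i" "i \<le> n"
  shows "n - i \<le> k i"
  using assms(3,2)
proof (induction i rule: inc_induct)
  case (step i)
  then have "k (Suc i) < k i" using assms(1) by (auto simp: strict_decreasing_def)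
  then show ?case using step by auto
qed simp

definition page_fillings ::
  "nat \<Rightarrow> nat \<Rightarrow> nat \<Rightarrow> (nat \<Rightarrow> nat) \<Rightarrow> (int \<times> int \<Rightarrow> nat) set" where
  "page_fillings n a b k = {\<phi> \<in> off_diag n a b \<rightarrow>\<^sub>E UNIV.
     decreasing_on (staircase n a b) (\<lambda>(i, j). if i = j then diag_entry n k i else \<phi> (i, j))}"

lemma has_sum_page_fillings:
  assumes n: "n \<ge> 1" and q: "0 < q" "q < 1" and k: "k \<in> strict_decreasing n"
  shows "((\<lambda>\<phi>. q ^ (\<Sum>c\<in>off_diag n a b. \<phi> c)) has_sum page_weight q n a b (\<lambda>p. k (n - p)))
    (page_fillings n a b k)"
proof -
  interpret page n a b q by standard (use n q in auto)
  let ?g = "\<lambda>(i, j). diag_entry n k i"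
  \<comment> \<open>Position \<open>p\<close> from the bottom is row \<open>n - p\<close>, and the
    shift by \<open>p\<close> undoes the subtraction in \<open>diag_entry\<close>.\<close>
  have seq: "strict_seq 0 ?g p = k (n - p)" if "p < n" for p
    using strict_decreasing_ge[OF k, of "n - p"] that
    by (auto simp: strict_seq_def cell_def bottom_def diag_entry_def nat_diff_distrib)
  have b1: "beyond (Suc 0) = off_diag n a b" and b0: "beyond 0 = staircase n a b"
    by (auto simp: beyond_def off_diag_def staircase_def)
  have w: "width 0 = n" by (simp add: width_def)
  have "((\<lambda>f. q ^ (\<Sum>c\<in>beyond (Suc 0). f c)) has_sum
      page_weight q (width 0) (a - 0) (b - 0) (strict_seq 0 ?g)) (fillings 0 ?g)"
  proof (rule has_sum_fillings)
    fix p assume "Suc p < width 0"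
    then show "strict_seq 0 ?g p < strict_seq 0 ?g (Suc p)"
      using k by (auto simp: w seq strict_decreasing_def)
  qed
  moreover have "page_weight q (width 0) (a - 0) (b - 0) (strict_seq 0 ?g) = page_weight q n a b (\<lambda>p. k (n - p))"
    unfolding w by (simp, rule page_weight_cong) (rule seq)
  moreover have "fillings 0 ?g = page_fillings n a b k"
  proof -
    have "decreasing_on (staircase n a b) (\<lambda>c. if c \<in> off_diag n a b then f c else ?g c) \<longleftrightarrow>
      decreasing_on (staircase n a b) (\<lambda>(i, j). if i = j then diag_entry n k i else f (i, j))" for f
      by (rule decreasing_on_cong) (auto simp: off_diag_def staircase_def split: if_splits)
    then show ?thesis
      unfolding fillings_def page_fillings_def b0 b1 by simp
  qed
  ultimately show ?thesis by (simp add: b1)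
qed

text \<open>Pages are numbered from 1, so the value 0 puts a diagonal cell before all other cells of
  its row.\<close>

primrec cell_page :: "book_cell \<Rightarrow> nat" where
  "cell_page (Diag i) = 0"
| "cell_page (Off k i j) = k"

primrec cell_col :: "book_cell \<Rightarrow> int" where
  "cell_col (Diag i) = i"
| "cell_col (Off k i j) = j"

text \<open>The natural labelling of the cells whose descents are the descents of Young books.\<close>

definition cell_less :: "book_cell \<Rightarrow> book_cell \<Rightarrow> bool" where
  "cell_less c c' \<longleftrightarrow> cell_row c < cell_row c' \<or> cell_row c = cell_row c' \<and>
     (cell_page c < cell_page c' \<or> cell_page c = cell_page c' \<and> cell_col c < cell_col c')"

section \<open>The cells of a book, their order and the descents of Young books\<close>

context
  fixes n m :: nat and rv sv :: "nat \<Rightarrow> nat"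
  assumes n1: "n \<ge> 1" and m1: "m \<ge> 1"
begin

abbreviation (input) "cells \<equiv> book_staircase n m rv sv"

abbreviation (input) "stair k \<equiv> staircase n (rv k) (sv k)"

abbreviation (input) "off k \<equiv> off_diag n (rv k) (sv k)"

text \<open>Generators of the order of the book; linear extensions and order-reversing maps are
  determined by them without passing to the transitive closure.\<close>

definition book_prec :: "book_cell \<Rightarrow> book_cell \<Rightarrow> bool" where
  "book_prec c c' \<longleftrightarrow> (\<exists>k\<in>{1..m}. \<exists>i j i' j'. (i, j) \<in> stair k \<and> (i', j') \<in> stair k \<and>
     c = page_cell k (i, j) \<and> c' = page_cell k (i', j') \<and> (i = i' \<and> j < j' \<or> j = j' \<and> i < i'))"

lemma cells_eq: "cells = Diag ` {1..int n} \<union> (\<Union>k\<in>{1..m}. page_cell k ` off k)"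
proof (intro equalityI subsetI)
  fix c assume "c \<in> cells"
  then obtain k i j where k: "k \<in> {1..m}" "(i, j) \<in> stair k" "c = page_cell k (i, j)"
    by (auto simp: book_staircase_def)
  show "c \<in> Diag ` {1..int n} \<union> (\<Union>k\<in>{1..m}. page_cell k ` off k)"
  proof (cases "i = j")
    case True
    then show ?thesis using k by (auto simp: page_cell_def staircase_def)
  next
    case False
    then have "(i, j) \<in> off k" using k by (auto simp: off_diag_def staircase_def)
    then show ?thesis using k by blast
  qed
next
  fix c assume "c \<in> Diag ` {1..int n} \<union> (\<Union>k\<in>{1..m}. page_cell k ` off k)"
  then show "c \<in> cells"
  proof
    assume "c \<in> Diag ` {1..int n}"
    then obtain i where i: "c = Diag i" "i \<in> {1..int n}" by auto
    then have "c = page_cell 1 (i, i)" "(i, i) \<in> stair 1"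
      by (auto simp: page_cell_def staircase_def)
    moreover have "1 \<in> {1..m}" using m1 by simp
    ultimately show ?thesis unfolding book_staircase_def by blast
  qed (auto simp: book_staircase_def off_diag_def)
qed

lemma Diag_in_cells: "Diag i \<in> cells \<longleftrightarrow> i \<in> {1..int n}"
  unfolding cells_eq by (auto simp: page_cell_def off_diag_def split: if_splits)

lemma Off_in_cells: "Off k i j \<in> cells \<longleftrightarrow> k \<in> {1..m} \<and> (i, j) \<in> off k"
proof
  assume "Off k i j \<in> cells"
  then show "k \<in> {1..m} \<and> (i, j) \<in> off k"
    unfolding cells_eq by (auto simp: page_cell_def off_diag_def split: if_splits)
next
  assume k: "k \<in> {1..m} \<and> (i, j) \<in> off k"
  then have "Off k i j = page_cell k (i, j)" by (auto simp: page_cell_def off_diag_def)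
  then show "Off k i j \<in> cells" unfolding cells_eq using k by blast
qed

lemma page_cell_in_cells: "k \<in> {1..m} \<Longrightarrow> c \<in> stair k \<Longrightarrow> page_cell k c \<in> cells"
  unfolding book_staircase_def by blast

lemma inj_page_cell: "inj_on (page_cell k) (off k)"
  by (auto simp: inj_on_def page_cell_def off_diag_def split: if_splits)

lemma finite_cells: "finite cells"
  unfolding cells_eq by (auto intro: finite_off_diag)

lemma sum_cells:
  "(\<Sum>c\<in>cells. f c) = (\<Sum>i=1..n. f (Diag (int i))) + (\<Sum>k=1..m. \<Sum>c\<in>off k. f (page_cell k c))"
proof -
  have "(\<Sum>c\<in>cells. f c) = (\<Sum>c\<in>Diag ` {1..int n}. f c) + (\<Sum>c\<in>(\<Union>k\<in>{1..m}. page_cell k ` off k). f c)"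
    unfolding cells_eq
  proof (rule sum.union_disjoint)
    show "Diag ` {1..int n} \<inter> (\<Union>k\<in>{1..m}. page_cell k ` off k) = {}"
      by (auto simp: page_cell_def off_diag_def)
  qed (auto intro: finite_off_diag)
  also have "(\<Sum>c\<in>Diag ` {1..int n}. f c) = (\<Sum>i=1..n. f (Diag (int i)))"
    by (subst sum.reindex) (auto simp: inj_on_def intro!: sum.reindex_bij_witness[of _ int nat])
  also have "(\<Sum>c\<in>(\<Union>k\<in>{1..m}. page_cell k ` off k). f c) = (\<Sum>k=1..m. \<Sum>c\<in>page_cell k ` off k. f c)"
  proof (rule sum.UNION_disjoint)
    show "\<forall>k\<in>{1..m}. \<forall>k'\<in>{1..m}. k \<noteq> k' \<longrightarrow> page_cell k ` off k \<inter> page_cell k' ` off k' = {}"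
      by (auto simp: page_cell_def off_diag_def split: if_splits)
  qed (auto intro: finite_off_diag)
  also have "\<dots> = (\<Sum>k=1..m. \<Sum>c\<in>off k. f (page_cell k c))"
    by (intro sum.cong sum.reindex[OF inj_page_cell, unfolded o_def] refl)
  finally show ?thesis .
qed

lemma card_cells:
  "card cells = n + (\<Sum>k=1..m. (n choose 2) + n * rv k + n * sv k + rv k * sv k)"
  using sum_cells[of "\<lambda>_. 1::nat"] by (simp add: card_off_diag)

lemma strict_total_cell_less: "strict_total_on cells cell_less"
proof -
  have "c = c'" if "c \<in> cells" "c' \<in> cells" "cell_row c = cell_row c'" "cell_page c = cell_page c'"
    "cell_col c = cell_col c'" for c c'
    using that by (cases c; cases c') (auto simp: Off_in_cells)
  then show ?thesis
    unfolding strict_total_on_def cell_less_def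
    by (intro conjI ballI impI) (auto, (metis linorder_neqE)+)
qed

lemma book_prec_cell_less: "book_prec c c' \<Longrightarrow> cell_less c c'"
  unfolding book_prec_def cell_less_def
  by (auto simp: page_cell_def staircase_def split: if_splits)

lemma young_books_eq: "young_books n m rv sv = linear_extensions cells book_prec"
proof -
  have "(\<forall>c\<in>cells. \<forall>c'\<in>cells. book_prec c c' \<longrightarrow> B c < B c') \<longleftrightarrow>
     (\<forall>k\<in>{1..m}. \<forall>i j j'. (i, j) \<in> stair k \<and> (i, j') \<in> stair k \<and> j < j' \<longrightarrow>
        B (page_cell k (i, j)) < B (page_cell k (i, j'))) \<and>
     (\<forall>k\<in>{1..m}. \<forall>i i' j. (i, j) \<in> stair k \<and> (i', j) \<in> stair k \<and> i < i' \<longrightarrow>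
        B (page_cell k (i, j)) < B (page_cell k (i', j)))" (is "?L \<longleftrightarrow> ?R") for B :: "book_cell \<Rightarrow> nat"
  proof
    assume ?L
    then show ?R
      using page_cell_in_cells unfolding book_prec_def by blast
  next
    assume R: ?R
    show ?L
      unfolding book_prec_def
    proof (intro ballI impI, elim bexE exE conjE)
      fix c c' k i j i' j'
      assume "k \<in> {1..m}" "(i, j) \<in> stair k" "(i', j') \<in> stair k"
        "c = page_cell k (i, j)" "c' = page_cell k (i', j')" "i = i' \<and> j < j' \<or> j = j' \<and> i < i'"
      then show "B c < B c'" using R by blast
    qed
  qed
  then show ?thesis
    unfolding young_books_def linear_extensions_def by (simp only:)
qed

text \<open>The labelling and \<open>descent_pair\<close> could disagree only for two cells of one
  row where the second is diagonal or lies further left on the same page. Monotonicity along rows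
  forbids both for cells met in increasing order of entries.\<close>

lemma descents_eq:
  assumes B: "B \<in> young_books n m rv sv"
  shows "descents cells B = order_descents cells cell_less B"
proof -
  have LE: "B \<in> linear_extensions cells book_prec" using B young_books_eq by simp
  have img: "B ` cells = {1..card cells}"
    using LE by (auto simp: linear_extensions_def bij_betw_def)
  have "descent_pair c c' \<longleftrightarrow> \<not> cell_less c c'"
    if c: "c \<in> cells" "c' \<in> cells" "B c < B c'" for c c'
  proof -
    have "c \<noteq> c'" using c by auto
    then have lin: "\<not> cell_less c c' \<longleftrightarrow> cell_less c' c"
      using strict_total_linear[OF strict_total_cell_less c(1,2)]
        strict_total_trans[OF strict_total_cell_less c(1,2,1)] strict_total_irrefl[OF strict_total_cell_less c(1)]
      by auto
    have no: "\<not> book_prec c' c"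
    proof
      assume "book_prec c' c"
      then have "B c' < B c" using LE c by (simp add: linear_extensions_def)
      then show False using c(3) by simp
    qed
    show ?thesis
    proof (cases "cell_row c' < cell_row c")
      case True
      then show ?thesis unfolding lin by (auto simp: descent_pair_def cell_less_def)
    next
      case row: False
      show ?thesis
      proof (cases "cell_row c' = cell_row c")
        case False
        then show ?thesis using row unfolding lin by (auto simp: descent_pair_def cell_less_def)
      next
        case eq: True
        show ?thesis
        proof (cases c')
          case (Diag i)
          have "c \<noteq> Diag i" using \<open>c \<noteq> c'\<close> Diag by simp
          then obtain k j where k: "c = Off k i j" using eq Diag by (cases c) auto
          then have "k \<in> {1..m}" "(i, j) \<in> stair k" "i < j" "(i, i) \<in> stair k"
            using c(1,2) Diag by (auto simp: Off_in_cells Diag_in_cells off_diag_def staircase_def)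
          then have "book_prec c' c"
            unfolding book_prec_def k Diag
            by (intro bexI[of _ k] exI[of _ i] exI[of _ j]) (auto simp: page_cell_def)
          then show ?thesis using no by simp
        next
          case c': (Off k' i' j')
          show ?thesis
          proof (cases c)
            case (Diag i)
            then show ?thesis
              using eq c' c(2) unfolding lin by (auto simp: descent_pair_def cell_less_def Off_in_cells)
          next
            case (Off k i j)
            have "\<not> (k' = k \<and> j' < j)"
            proof
              assume *: "k' = k \<and> j' < j"
              have "k \<in> {1..m}" "(i, j) \<in> off k" "(i, j') \<in> off k"
                using c(1,2) c' Off eq * by (auto simp: Off_in_cells)
              then have "book_prec c' c"
                unfolding book_prec_def c' Off using * eq c' Off
                by (intro bexI[of _ k] exI[of _ i] exI[of _ j'] exI[of _ j]) (auto simp: page_cell_def off_diag_def)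
              then show False using no by simp
            qed
            then show ?thesis
              using eq c' Off unfolding lin by (auto simp: descent_pair_def cell_less_def)
          qed
        qed
      qed
    qed
  qed
  moreover have "inv_into cells B i \<in> cells" "B (inv_into cells B i) = i" if "1 \<le> i" "i \<le> card cells" for i
  proof -
    have "i \<in> B ` cells" using that img by simp
    then show "inv_into cells B i \<in> cells" "B (inv_into cells B i) = i"
      by (auto intro: inv_into_into f_inv_into_f)
  qed
  ultimately have "descent_pair (inv_into cells B i) (inv_into cells B (i + 1)) \<longleftrightarrow>
      \<not> cell_less (inv_into cells B i) (inv_into cells B (i + 1))" if "1 \<le> i" "i < card cells" for i
    using that by simp
  then show ?thesis
    unfolding descents_def order_descents_def by blast
qed

lemma has_sum_books:
  fixes q :: real
  assumes q: "0 < q" "q < 1"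
  shows "((\<lambda>f. q ^ (\<Sum>c\<in>cells. f c)) has_sum
    (\<Sum>B\<in>young_books n m rv sv. q ^ maj cells B) / (\<Prod>i=1..card cells. 1 - q ^ i))
    (order_reversing cells book_prec)"
proof -
  have "(\<Sum>B\<in>young_books n m rv sv. q ^ maj cells B) =
      (\<Sum>B\<in>linear_extensions cells book_prec. q ^ \<Sum>(order_descents cells cell_less B))"
    unfolding maj_def young_books_eq[symmetric] by (intro sum.cong) (auto simp: descents_eq)
  moreover have "((\<lambda>f. q ^ (\<Sum>c\<in>cells. f c)) has_sum
      (\<Sum>B\<in>linear_extensions cells book_prec. q ^ \<Sum>(order_descents cells cell_less B)) /
        (\<Prod>i=1..card cells. 1 - q ^ i)) (order_reversing cells book_prec)"
    by (rule has_sum_order_reversing[OF finite_cells strict_total_cell_less q]) (rule book_prec_cell_less)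
  ultimately show ?thesis by (simp only:)
qed

lemma order_reversing_iff:
  "f \<in> order_reversing cells book_prec \<longleftrightarrow> f \<in> cells \<rightarrow>\<^sub>E UNIV \<and>
    (\<forall>k\<in>{1..m}. decreasing_on (stair k) (\<lambda>c. f (page_cell k c)))"
proof -
  have "(\<forall>c\<in>cells. \<forall>c'\<in>cells. book_prec c c' \<longrightarrow> f c' \<le> f c) \<longleftrightarrow>
     (\<forall>k\<in>{1..m}. (\<forall>i j j'. (i, j) \<in> stair k \<and> (i, j') \<in> stair k \<and> j < j' \<longrightarrow>
        f (page_cell k (i, j')) \<le> f (page_cell k (i, j))) \<and>
     (\<forall>i i' j. (i, j) \<in> stair k \<and> (i', j) \<in> stair k \<and> i < i' \<longrightarrow>
        f (page_cell k (i', j)) \<le> f (page_cell k (i, j))))" (is "?L \<longleftrightarrow> ?R")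
  proof
    assume ?L
    then show ?R
      using page_cell_in_cells unfolding book_prec_def by blast
  next
    assume R: ?R
    show ?L
      unfolding book_prec_def
    proof (intro ballI impI, elim bexE exE conjE)
      fix c c' k i j i' j'
      assume "k \<in> {1..m}" "(i, j) \<in> stair k" "(i', j') \<in> stair k"
        "c = page_cell k (i, j)" "c' = page_cell k (i', j')" "i = i' \<and> j < j' \<or> j = j' \<and> i < i'"
      then show "f c' \<le> f c" using R by blast
    qed
  qed
  then show ?thesis
    unfolding order_reversing_def decreasing_on_staircase_iff by (simp only: mem_Collect_eq)
qed

section \<open>Splitting a filling into its diagonal and its pages\<close>

definition assemble :: "(nat \<Rightarrow> nat) \<times> (nat \<Rightarrow> int \<times> int \<Rightarrow> nat) \<Rightarrow> book_cell \<Rightarrow> nat" where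
  "assemble = (\<lambda>(k, \<phi>). \<lambda>c\<in>cells. case c of Diag i \<Rightarrow> diag_entry n k i | Off h i j \<Rightarrow> \<phi> h (i, j))"

text \<open>The diagonal is stored with the shift \<open>n - i\<close>, so that it lands in
  \<open>strict_decreasing\<close> and directly gives the exponents of the Jackson sum.\<close>

definition disassemble :: "(book_cell \<Rightarrow> nat) \<Rightarrow> (nat \<Rightarrow> nat) \<times> (nat \<Rightarrow> int \<times> int \<Rightarrow> nat)" where
  "disassemble f = (\<lambda>i\<in>{1..n}. f (Diag (int i)) + (n - i), \<lambda>h\<in>{1..m}. \<lambda>c\<in>off h. f (page_cell h c))"

lemma assemble_page_cell:
  assumes "h \<in> {1..m}" "(i, j) \<in> stair h"
  shows "assemble (k, \<phi>) (page_cell h (i, j)) = (if i = j then diag_entry n k i else \<phi> h (i, j))"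
  using page_cell_in_cells[OF assms] by (auto simp: assemble_def page_cell_def)

lemma disassemble_assemble:
  assumes "x \<in> (SIGMA k:strict_decreasing n. PiE {1..m} (\<lambda>h. page_fillings n (rv h) (sv h) k))"
  shows "disassemble (assemble x) = x"
proof -
  obtain k \<phi> where x: "x = (k, \<phi>)" by (cases x)
  have k: "k \<in> strict_decreasing n" and \<phi>: "\<phi> \<in> PiE {1..m} (\<lambda>h. page_fillings n (rv h) (sv h) k)"
    using assms x by auto
  have "(\<lambda>i\<in>{1..n}. assemble x (Diag (int i)) + (n - i)) = k"
  proof (rule extensionalityI[of _ "{1..n}"])
    show "k \<in> extensional {1..n}" using k by (auto simp: strict_decreasing_def PiE_def)
    show "(\<lambda>i\<in>{1..n}. assemble x (Diag (int i)) + (n - i)) i = k i" if "i \<in> {1..n}" for i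
      using that strict_decreasing_ge[OF k, of i]
      by (auto simp: x assemble_def Diag_in_cells diag_entry_def)
  qed simp
  moreover have "(\<lambda>h\<in>{1..m}. \<lambda>c\<in>off h. assemble x (page_cell h c)) = \<phi>"
  proof (rule extensionalityI[of _ "{1..m}"])
    show "\<phi> \<in> extensional {1..m}" using \<phi> by (auto simp: PiE_def)
    fix h assume h: "h \<in> {1..m}"
    have "(\<lambda>c\<in>off h. assemble x (page_cell h c)) = \<phi> h"
    proof (rule extensionalityI[of _ "off h"])
      have "\<phi> h \<in> page_fillings n (rv h) (sv h) k" using \<phi> h by auto
      then show "\<phi> h \<in> extensional (off h)" by (auto simp: page_fillings_def PiE_def)
      fix c assume "c \<in> off h"
      then show "(\<lambda>c\<in>off h. assemble x (page_cell h c)) c = \<phi> h c"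
        using h by (cases c) (auto simp: x assemble_page_cell off_diag_def)
    qed simp
    then show "(\<lambda>h\<in>{1..m}. \<lambda>c\<in>off h. assemble x (page_cell h c)) h = \<phi> h" using h by simp
  qed simp
  ultimately show ?thesis by (simp add: disassemble_def x)
qed

lemma assemble_disassemble:
  assumes "f \<in> order_reversing cells book_prec"
  shows "assemble (disassemble f) = f"
proof (rule extensionalityI[of _ cells])
  show "f \<in> extensional cells" using assms by (auto simp: order_reversing_def PiE_def)
  fix c assume "c \<in> cells"
  then show "assemble (disassemble f) c = f c"
    by (cases c) (auto simp: assemble_def disassemble_def Diag_in_cells Off_in_cells diag_entry_def
        page_cell_def off_diag_def)
qed (simp add: assemble_def split: prod.split)

lemma assemble_in:
  assumes "x \<in> (SIGMA k:strict_decreasing n. PiE {1..m} (\<lambda>h. page_fillings n (rv h) (sv h) k))"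
  shows "assemble x \<in> order_reversing cells book_prec"
proof -
  obtain k \<phi> where x: "x = (k, \<phi>)" by (cases x)
  have \<phi>: "\<phi> \<in> PiE {1..m} (\<lambda>h. page_fillings n (rv h) (sv h) k)"
    using assms x by auto
  have "decreasing_on (stair h) (\<lambda>c. assemble x (page_cell h c))" if h: "h \<in> {1..m}" for h
  proof -
    have "\<phi> h \<in> page_fillings n (rv h) (sv h) k" using \<phi> h by auto
    then have "decreasing_on (stair h) (\<lambda>(i, j). if i = j then diag_entry n k i else \<phi> h (i, j))"
      by (simp add: page_fillings_def)
    moreover have "decreasing_on (stair h) (\<lambda>c. assemble x (page_cell h c)) \<longleftrightarrow>
      decreasing_on (stair h) (\<lambda>(i, j). if i = j then diag_entry n k i else \<phi> h (i, j))"
      unfolding decreasing_on_def x using assemble_page_cell[OF h] by auto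
    ultimately show ?thesis by simp
  qed
  then show ?thesis
    unfolding order_reversing_iff by (auto simp: assemble_def split: prod.split)
qed

lemma disassemble_in:
  assumes f: "f \<in> order_reversing cells book_prec"
  shows "disassemble f \<in> (SIGMA k:strict_decreasing n. PiE {1..m} (\<lambda>h. page_fillings n (rv h) (sv h) k))"
proof -
  let ?k = "\<lambda>i\<in>{1..n}. f (Diag (int i)) + (n - i)"
  have dec: "decreasing_on (stair h) (\<lambda>c. f (page_cell h c))" if "h \<in> {1..m}" for h
    using f that by (simp add: order_reversing_iff)
  have "?k \<in> strict_decreasing n"
    unfolding strict_decreasing_def
  proof (intro CollectI conjI ballI impI)
    fix i j assume ij: "i \<in> {1..n}" "j \<in> {1..n}" "i < j"
    have 1: "1 \<in> {1..m}" using m1 by simp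
    have S: "(int i, int i) \<in> stair 1" "(int i, int j) \<in> stair 1" "(int j, int j) \<in> stair 1"
      using ij by (auto simp: staircase_def)
    \<comment> \<open>Diagonal cells share no row or column; they are compared through the cell in
      row \<open>i\<close> and column \<open>j\<close> of the first page.\<close>
    have "f (page_cell 1 (int j, int j)) \<le> f (page_cell 1 (int i, int j))"
      "f (page_cell 1 (int i, int j)) \<le> f (page_cell 1 (int i, int i))"
      using dec[OF 1] S ij unfolding decreasing_on_staircase_iff by auto
    then have "f (Diag (int j)) \<le> f (Diag (int i))" by (simp add: page_cell_def)
    then show "?k j < ?k i" using ij by simp
  qed simp
  moreover have "(\<lambda>c\<in>off h. f (page_cell h c)) \<in> page_fillings n (rv h) (sv h) ?k" if h: "h \<in> {1..m}" for h
  proof -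
    have "decreasing_on (stair h) (\<lambda>(i, j). if i = j then diag_entry n ?k i else (\<lambda>c\<in>off h. f (page_cell h c)) (i, j)) \<longleftrightarrow>
      decreasing_on (stair h) (\<lambda>c. f (page_cell h c))"
    proof (rule decreasing_on_cong)
      show "(case c of (i, j) \<Rightarrow> if i = j then diag_entry n ?k i else (\<lambda>c\<in>off h. f (page_cell h c)) (i, j))
        = f (page_cell h c)" if "c \<in> stair h" for c
        using that by (cases c) (auto simp: diag_entry_def page_cell_def off_diag_def staircase_def)
    qed
    then show ?thesis using dec[OF h] by (simp add: page_fillings_def del: One_nat_def)
  qed
  ultimately show ?thesis by (simp add: disassemble_def del: One_nat_def)
qed

text \<open>With the diagonal fixed the pages are independent, so each fibre sum is a product of
  page weights; the total is already known from the Young books.\<close>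

lemma has_sum_diagonals:
  assumes q: "0 < q" "q < 1"
  shows "((\<lambda>k. q ^ (\<Sum>i=1..n. k i - (n - i)) *
        (\<Prod>h=1..m. page_weight q n (rv h) (sv h) (\<lambda>p. k (n - p)))) has_sum
      (\<Sum>B\<in>young_books n m rv sv. q ^ maj cells B) / (\<Prod>i=1..card cells. 1 - q ^ i))
    (strict_decreasing n)"
proof (rule has_sum_SigmaD)
  let ?S = "SIGMA k:strict_decreasing n. PiE {1..m} (\<lambda>h. page_fillings n (rv h) (sv h) k)"
  let ?F = "\<lambda>(k, \<phi>). q ^ (\<Sum>i=1..n. k i - (n - i)) * (\<Prod>h\<in>{1..m}. q ^ (\<Sum>c\<in>off h. \<phi> h c))"
  let ?Y = "(\<Sum>B\<in>young_books n m rv sv. q ^ maj cells B) / (\<Prod>i=1..card cells. 1 - q ^ i)"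
  have "((\<lambda>f. q ^ (\<Sum>c\<in>cells. f c)) has_sum ?Y) (order_reversing cells book_prec) \<longleftrightarrow> (?F has_sum ?Y) ?S"
  proof (rule has_sum_reindex_bij_witness[where i = assemble and j = disassemble])
    show "?F (disassemble f) = q ^ (\<Sum>c\<in>cells. f c)" for f
      by (simp add: disassemble_def sum_cells power_add power_sum)
  qed (rule assemble_disassemble disassemble_in assemble_in disassemble_assemble refl, assumption?)+
  then show "(?F has_sum ?Y) ?S" using has_sum_books[OF q] by simp
  show "((\<lambda>\<phi>. ?F (k, \<phi>)) has_sum q ^ (\<Sum>i=1..n. k i - (n - i)) *
      (\<Prod>h=1..m. page_weight q n (rv h) (sv h) (\<lambda>p. k (n - p))))
      (PiE {1..m} (\<lambda>h. page_fillings n (rv h) (sv h) k))" if "k \<in> strict_decreasing n" for k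
    unfolding prod.case
    by (intro has_sum_cmult_right has_sum_prod_PiE has_sum_page_fillings n1 q that) auto
qed

end


section \<open>The Jackson integral\<close>

definition pair_product :: "nat \<Rightarrow> (nat \<Rightarrow> real) \<Rightarrow> real" where
  "pair_product n x = (\<Prod>(i, j)\<in>{(i, j). 1 \<le> i \<and> i < j \<and> j \<le> n}. \<bar>x j - x i\<bar>)"

lemma finite_pairs: "finite {(i, j). 1 \<le> i \<and> i < j \<and> j \<le> (n::nat)}"
  by (rule finite_subset[of _ "{1..n} \<times> {1..n}"]) auto

text \<open>A permutation need not preserve the pairs with \<open>i < j\<close>. The square,
  however, runs over all ordered pairs of distinct indices, where invariance is plain reindexing,
  and nonnegativity allows the root to be taken.\<close>

lemma pair_product_permute:
  assumes \<pi>: "\<pi> permutes {1..n}"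
  shows "pair_product n (x \<circ> \<pi>) = pair_product n x"
proof -
  let ?T = "{(i, j). 1 \<le> i \<and> i < j \<and> j \<le> n}"
  let ?T' = "{(i, j). 1 \<le> j \<and> j < i \<and> i \<le> n}"
  let ?A = "{(i, j). i \<in> {1..n} \<and> j \<in> {1..n} \<and> i \<noteq> j}"
  have sq: "(pair_product n y)\<^sup>2 = (\<Prod>(i, j)\<in>?A. \<bar>y j - y i\<bar>)" for y
  proof -
    have "(\<Prod>(i, j)\<in>?T'. \<bar>y j - y i\<bar>) = (\<Prod>(i, j)\<in>?T. \<bar>y j - y i\<bar>)"
      by (rule prod.reindex_bij_witness[of _ prod.swap prod.swap]) (auto simp: abs_minus_commute)
    moreover have "?A = ?T \<union> ?T'" by auto
    moreover have "(\<Prod>(i, j)\<in>?T \<union> ?T'. \<bar>y j - y i\<bar>) =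
        (\<Prod>(i, j)\<in>?T. \<bar>y j - y i\<bar>) * (\<Prod>(i, j)\<in>?T'. \<bar>y j - y i\<bar>)"
    proof (rule prod.union_disjoint)
      show "finite ?T'"
        by (rule finite_subset[of _ "{1..n} \<times> {1..n}"]) auto
    qed (use finite_pairs in auto)
    ultimately show ?thesis
      by (simp add: pair_product_def power2_eq_square)
  qed
  have "(\<Prod>(i, j)\<in>?A. \<bar>(x \<circ> \<pi>) j - (x \<circ> \<pi>) i\<bar>) = (\<Prod>(i, j)\<in>?A. \<bar>x j - x i\<bar>)"
  proof (rule prod.reindex_bij_witness[of _ "map_prod (inv_into UNIV \<pi>) (inv_into UNIV \<pi>)" "map_prod \<pi> \<pi>"])
    have inj: "inj \<pi>" and inv: "inv_into UNIV \<pi> permutes {1..n}"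
      using \<pi> permutes_inj permutes_inv by auto
    note inverses = permutes_inverses[OF \<pi>]
    show "map_prod (inv_into UNIV \<pi>) (inv_into UNIV \<pi>) (map_prod \<pi> \<pi> c) = c"
      "map_prod \<pi> \<pi> (map_prod (inv_into UNIV \<pi>) (inv_into UNIV \<pi>) c) = c" for c
      by (cases c, simp add: inverses)+
    show "map_prod \<pi> \<pi> c \<in> ?A" if "c \<in> ?A" for c
      using that permutes_in_image[OF \<pi>] injD[OF inj] by (cases c) (auto simp del: atLeastAtMost_iff)
    show "map_prod (inv_into UNIV \<pi>) (inv_into UNIV \<pi>) c \<in> ?A" if "c \<in> ?A" for c
      using that permutes_in_image[OF inv] injD[OF permutes_inj[OF inv]]
      by (cases c) (auto simp del: atLeastAtMost_iff)
  qed auto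
  then have "(pair_product n (x \<circ> \<pi>))\<^sup>2 = (pair_product n x)\<^sup>2"
    by (simp only: sq)
  moreover have "pair_product n y \<ge> 0" for y
    unfolding pair_product_def by (intro prod_nonneg) auto
  ultimately show ?thesis by (simp add: power2_eq_iff_nonneg)
qed

lemma pair_product_eq_0:
  assumes "\<not> inj_on x {1..n}"
  shows "pair_product n x = 0"
proof -
  obtain i j where "i \<in> {1..n}" "j \<in> {1..n}" "x i = x j" "i < j"
    using assms unfolding inj_on_def by (metis linorder_neqE_nat)
  then show ?thesis
    unfolding pair_product_def by (intro prod_zero[OF finite_pairs] bexI[of _ "(i, j)"]) auto
qed

text \<open>Reversing the indices turns decreasing exponents into decreasing variables, so every
  difference is positive and the absolute values disappear.\<close>

lemma pair_product_vandermonde: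
  assumes q: "0 < q" "q < 1" and k: "k \<in> strict_decreasing n"
  shows "pair_product n (\<lambda>i. q ^ k i) = vandermonde n (\<lambda>p. q ^ k (n - p))"
proof -
  have "vandermonde n (\<lambda>p. q ^ k (n - p)) =
      (\<Prod>(j, i)\<in>(SIGMA j:{..<n}. {..<j}). q ^ k (n - i) - q ^ k (n - j))"
    unfolding vandermonde_def by (rule prod.Sigma) auto
  also have "\<dots> = pair_product n (\<lambda>i. q ^ k i)"
    unfolding pair_product_def
  proof (rule prod.reindex_bij_witness[of _ "\<lambda>(i, j). (n - i, n - j)" "\<lambda>(j, i). (n - j, n - i)"])
    fix c assume c: "c \<in> (SIGMA j:{..<n}. {..<j})"
    obtain j i where ji: "c = (j, i)" by (cases c)
    have "k (n - i) < k (n - j)"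
      using c k by (auto simp: ji strict_decreasing_def)
    then have "q ^ k (n - j) < q ^ k (n - i)"
      using q by (intro power_strict_decreasing) auto
    then show "(case case c of (j, i) \<Rightarrow> (n - j, n - i) of (i, j) \<Rightarrow> \<bar>q ^ k j - q ^ k i\<bar>) =
        (case c of (j, i) \<Rightarrow> q ^ k (n - i) - q ^ k (n - j))"
      by (simp add: ji)
  qed auto
  finally show ?thesis by simp
qed

lemma page_weight_eq:
  assumes q: "0 < q" "q < 1" and k: "k \<in> strict_decreasing n"
  shows "page_weight q n a b (\<lambda>p. k (n - p)) = page_const q n a b *
    ((\<Prod>i=1..n. (q ^ k i) ^ a * q_poch (q * q ^ k i) q b) * pair_product n (\<lambda>i. q ^ k i))"
proof -
  have "(\<Prod>p<n. (q ^ k (n - p)) ^ a * q_poch (q * q ^ k (n - p)) q b) =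
      (\<Prod>i=1..n. (q ^ k i) ^ a * q_poch (q * q ^ k i) q b)"
    by (rule prod.reindex_bij_witness[of _ "\<lambda>i. n - i" "\<lambda>p. n - p"]) auto
  then show ?thesis
    by (simp add: page_weight_def pair_product_vandermonde[OF assms])
qed

section \<open>Conversion to q-factorials\<close>

lemma q_fact_eq: "q_fact q N = (\<Prod>i=1..N. 1 - q ^ i) / (1 - q) ^ N"
  by (simp add: q_fact_def q_bracket_def prod_dividef)

lemma q_poch_q_eq: "q_poch q q N = (\<Prod>i=1..N. 1 - q ^ i)"
  by (induction N) (simp_all add: q_poch_def)

lemma q_superfact_eq: "q_superfact q l = q_poch_superfact q l / (1 - q) ^ (l choose 2)"
proof (induction l)
  case (Suc l)
  have "q_superfact q (Suc l) = q_superfact q l * q_fact q l"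
  proof (cases "l = 0")
    case False
    then have "{1..<Suc l} = insert l {1..<l}" by auto
    then show ?thesis unfolding q_superfact_def by simp
  qed (simp add: q_superfact_def q_fact_def)
  then show ?case
    by (simp add: Suc.IH q_fact_eq q_poch_superfact_Suc q_poch_q_eq numeral_2_eq_2 power_add)
qed (simp add: q_superfact_def q_poch_superfact_def binomial_eq_0)

lemma choose_two_add: "(a + b) choose 2 = (a choose 2) + (b choose 2) + a * b"
  by (induction b) (simp_all add: numeral_2_eq_2)

text \<open>The exponent of \<open>1 - q\<close> is \<open>(n + a + b) choose 2\<close> minus
  \<open>a choose 2\<close> and \<open>b choose 2\<close>, the surplus left by the three
  superfactorials.\<close>

lemma inverse_page_const:
  assumes q: "0 < q" "q < 1"
  shows "(1 - q) ^ ((n choose 2) + n * a + n * b + a * b) *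
      (q_superfact q (n + a + b) / (q_superfact q a * q_superfact q b)) *
      q ^ (a * (n choose 2) + (n choose 3)) = inverse (page_const q n a b)"
proof -
  have "(n + a + b) choose 2 = (a choose 2) + (b choose 2) + ((n choose 2) + n * a + n * b + a * b)"
    unfolding choose_two_add by (simp add: algebra_simps)
  then have "(1 - q) ^ ((n + a + b) choose 2) =
      (1 - q) ^ (a choose 2) * (1 - q) ^ (b choose 2) * (1 - q) ^ ((n choose 2) + n * a + n * b + a * b)"
    by (simp only: power_add)
  moreover have "1 - q \<noteq> 0" using q by simp
  ultimately show ?thesis
    using q_poch_superfact_pos[OF q, of a] q_poch_superfact_pos[OF q, of b]
      q_poch_superfact_pos[OF q, of "n + a + b"]
    unfolding q_superfact_eq page_const_def by (simp add: divide_simps)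
qed

theorem theorem1p1:
  fixes n m r s N :: nat and rv sv :: "nat \<Rightarrow> nat" and q :: real
  assumes "n \<ge> 1" and "m \<ge> 1"
    and "(\<Sum>k=1..m. rv k) = r" and "(\<Sum>k=1..m. sv k) = s"
    and "N = m * (n choose 2) + (r + s + 1) * n + (\<Sum>k=1..m. rv k * sv k)"
    and "0 < q" and "q < 1"
  shows "1 / fact n *
      jackson_integral q n
        (\<lambda>x. \<Prod>k=1..m.
          (\<Prod>i=1..n. x i ^ rv k * q_poch (q * x i) q (sv k)) *
          (\<Prod>(i, j)\<in>{(i, j). 1 \<le> i \<and> i < j \<and> j \<le> n}. \<bar>x j - x i\<bar>))
    = q ^ ((r + 1) * (n choose 2) + m * (n choose 3)) *
      (1 / q_fact q N) *
      (\<Prod>k=1..m. q_superfact q (n + rv k + sv k) / (q_superfact q (rv k) * q_superfact q (sv k))) *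
      (\<Sum>B\<in>young_books n m rv sv. q ^ maj (book_staircase n m rv sv) B)"
proof -
  note q = \<open>0 < q\<close> \<open>q < 1\<close>
  define C where "C = book_staircase n m rv sv"
  define Y where "Y = (\<Sum>B\<in>young_books n m rv sv. q ^ maj C B)"
  define e where "e h = (n choose 2) + n * rv h + n * sv h + rv h * sv h" for h
  define G where "G = (\<lambda>k h. (\<Prod>i=1..n. (q ^ k i) ^ rv h * q_poch (q * q ^ k i) q (sv h)) *
    pair_product n (\<lambda>i. q ^ k i))"
  define F where "F k = (\<Prod>h=1..m. G k h) * q ^ (\<Sum>i=1..n. k i)" for k
  define K where "K h = page_const q n (rv h) (sv h)" for h
  have card: "card C = N"
    unfolding C_def card_cells[OF assms(1,2)] assms(3,4,5)[symmetric] assms(5)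
    by (simp add: sum.distrib sum_distrib_left[symmetric] sum_distrib_right[symmetric] assms(3,4) algebra_simps)
  have N_eq: "N = n + (\<Sum>h=1..m. e h)"
    using card card_cells[OF assms(1,2), of rv sv] by (simp add: C_def e_def)
  have K_pos: "K h > 0" for h
    using q q_poch_superfact_pos[OF q] by (simp add: K_def page_const_def)
  define P where "P = (\<Prod>h=1..m. inverse (K h))"

  \<comment> \<open>Scaled so that the summand becomes the Jackson integrand: \<open>P\<close>
    cancels the page constants, and \<open>q ^ (n choose 2)\<close> turns the entries
    \<open>k i - (n - i)\<close> back into the exponents \<open>k i\<close>.\<close>
  have "((\<lambda>k. (q ^ (n choose 2) * P) * (q ^ (\<Sum>i=1..n. k i - (n - i)) *
        (\<Prod>h=1..m. page_weight q n (rv h) (sv h) (\<lambda>p. k (n - p))))) has_sum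
      (q ^ (n choose 2) * P) * (Y / (\<Prod>i=1..N. 1 - q ^ i))) (strict_decreasing n)"
    using has_sum_diagonals[OF assms(1,2) q, of rv sv]
    unfolding Y_def card[symmetric] C_def by (rule has_sum_cmult_right)
  also have "?this \<longleftrightarrow> (F has_sum (q ^ (n choose 2) * P) * (Y / (\<Prod>i=1..N. 1 - q ^ i))) (strict_decreasing n)"
  proof (rule has_sum_cong)
    fix k assume k: "k \<in> strict_decreasing n"
    have "(\<Sum>i=1..n. k i) = (\<Sum>i=1..n. (n - i) + (k i - (n - i)))"
      by (intro sum.cong refl le_add_diff_inverse[symmetric] strict_decreasing_ge[OF k]) auto
    also have "\<dots> = (n choose 2) + (\<Sum>i=1..n. k i - (n - i))"
    proof -
      have "(\<Sum>i=1..n. n - i) = (\<Sum>t<n. t)"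
        by (rule sum.reindex_bij_witness[of _ "\<lambda>t. n - t" "\<lambda>i. n - i"]) auto
      also have "\<dots> = (n choose 2)"
        by (simp add: choose_two atLeast0LessThan[symmetric] Sum_Ico_nat)
      finally show ?thesis
        unfolding sum.distrib by (rule arg_cong)
    qed
    finally have "q ^ (\<Sum>i=1..n. k i) = q ^ (n choose 2) * q ^ (\<Sum>i=1..n. k i - (n - i))"
      by (simp add: power_add)
    moreover have "P * (\<Prod>h=1..m. page_weight q n (rv h) (sv h) (\<lambda>p. k (n - p))) = (\<Prod>h=1..m. G k h)"
      unfolding P_def prod.distrib[symmetric] page_weight_eq[OF q k] K_def[symmetric] G_def
      using K_pos by (intro prod.cong) (auto simp: less_imp_neq[symmetric])
    ultimately show "(q ^ (n choose 2) * P) * (q ^ (\<Sum>i=1..n. k i - (n - i)) *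
        (\<Prod>h=1..m. page_weight q n (rv h) (sv h) (\<lambda>p. k (n - p)))) = F k"
      unfolding F_def by (metis (no_types, lifting) mult.assoc mult.commute)
  qed
  finally have "(F has_sum fact n * ((q ^ (n choose 2) * P) * (Y / (\<Prod>i=1..N. 1 - q ^ i)))) ({1..n} \<rightarrow>\<^sub>E UNIV)"
    unfolding strict_decreasing_def
  proof (rule has_sum_symmetrize[rotated 2])
    fix k \<pi> assume \<pi>: "\<pi> permutes {1..n}"
    have "(\<Prod>i=1..n. (q ^ k (\<pi> i)) ^ rv h * q_poch (q * q ^ k (\<pi> i)) q (sv h)) =
        (\<Prod>i=1..n. (q ^ k i) ^ rv h * q_poch (q * q ^ k i) q (sv h))" for h
      using prod.permute[OF \<pi>, of "\<lambda>i. (q ^ k i) ^ rv h * q_poch (q * q ^ k i) q (sv h)"]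
      by (simp add: o_def)
    moreover have "(\<Sum>i=1..n. k (\<pi> i)) = (\<Sum>i=1..n. k i)"
      using sum.permute[OF \<pi>, of k] by (simp add: o_def)
    moreover have "pair_product n (\<lambda>i. q ^ k (\<pi> i)) = pair_product n (\<lambda>i. q ^ k i)"
      using pair_product_permute[OF \<pi>, of "\<lambda>i. q ^ k i"] by (simp add: o_def)
    ultimately show "F (k \<circ> \<pi>) = F k"
      unfolding F_def G_def o_def by (simp only:)
  next
    fix k :: "nat \<Rightarrow> nat" assume "\<not> inj_on k {1..n}"
    then have "\<not> inj_on (\<lambda>i. q ^ k i) {1..n}"
      unfolding inj_on_def by metis
    \<comment> \<open>A single vanishing page factor is enough, and \<open>m \<ge> 1\<close>
      provides the first page.\<close>
    then have "G k 1 = 0"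
      by (simp add: G_def pair_product_eq_0)
    then have "(\<Prod>h=1..m. G k h) = 0"
      using \<open>m \<ge> 1\<close> by (intro prod_zero bexI[of _ 1]) auto
    then show "F k = 0" by (simp add: F_def)
  qed
  then have infsum_F: "(\<Sum>\<^sub>\<infinity>k\<in>{1..n} \<rightarrow>\<^sub>E UNIV. F k) =
      fact n * ((q ^ (n choose 2) * P) * (Y / (\<Prod>i=1..N. 1 - q ^ i)))"
    by (rule infsumI)
  have "jackson_integral q n (\<lambda>x. \<Prod>k=1..m.
          (\<Prod>i=1..n. x i ^ rv k * q_poch (q * x i) q (sv k)) *
          (\<Prod>(i, j)\<in>{(i, j). 1 \<le> i \<and> i < j \<and> j \<le> n}. \<bar>x j - x i\<bar>))
    = (1 - q) ^ n * (\<Sum>\<^sub>\<infinity>k\<in>{1..n} \<rightarrow>\<^sub>E UNIV. F k)"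
    unfolding jackson_integral_def F_def G_def pair_product_def
    by (intro arg_cong[of _ _ "\<lambda>u. (1 - q) ^ n * u"] infsum_cong arg_cong2[of _ _ _ _ "(*)"] prod.cong refl) auto
  then have "1 / fact n * jackson_integral q n (\<lambda>x. \<Prod>k=1..m.
          (\<Prod>i=1..n. x i ^ rv k * q_poch (q * x i) q (sv k)) *
          (\<Prod>(i, j)\<in>{(i, j). 1 \<le> i \<and> i < j \<and> j \<le> n}. \<bar>x j - x i\<bar>))
    = (1 - q) ^ n * (q ^ (n choose 2) * P) * (Y / (\<Prod>i=1..N. 1 - q ^ i))"
    unfolding infsum_F by simp
  \<comment> \<open>Each diagonal cell receives a factor \<open>1 - q\<close> from the Jackson
    measure and each other cell one from the page constants; the resulting
    \<open>(1 - q) ^ N\<close> turns the product of the \<open>1 - q ^ i\<close> into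
    \<open>q_fact q N\<close>.\<close>
  also have "(1 - q) ^ n * (q ^ (n choose 2) * P) = (1 - q) ^ N * q ^ ((r + 1) * (n choose 2) + m * (n choose 3)) *
      (\<Prod>k=1..m. q_superfact q (n + rv k + sv k) / (q_superfact q (rv k) * q_superfact q (sv k)))"
  proof -
    have "P = (\<Prod>h=1..m. (1 - q) ^ e h *
        (q_superfact q (n + rv h + sv h) / (q_superfact q (rv h) * q_superfact q (sv h))) *
        q ^ (rv h * (n choose 2) + (n choose 3)))"
      unfolding P_def K_def e_def inverse_page_const[OF q] ..
    also have "\<dots> = (1 - q) ^ (\<Sum>h=1..m. e h) *
        (\<Prod>k=1..m. q_superfact q (n + rv k + sv k) / (q_superfact q (rv k) * q_superfact q (sv k))) *
        q ^ (\<Sum>h=1..m. rv h * (n choose 2) + (n choose 3))"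
      by (simp only: prod.distrib power_sum)
    also have "(\<Sum>h=1..m. rv h * (n choose 2) + (n choose 3)) = r * (n choose 2) + m * (n choose 3)"
      using assms(3) by (simp add: sum.distrib sum_distrib_right[symmetric])
    finally show ?thesis
      by (simp add: N_eq power_add)
  qed
  finally show ?thesis
    by (simp add: q_fact_eq Y_def C_def)
qed

end
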